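(* Let $(R,\mathfrak m)$ be a Noetherian local ring and $I$ a proper ideal of $R$. Then, for every $a,b\in R$, the rings $R(I)_{a,b}$ have the same Hilbert function (i.e. the Hilbert function of $R(I)_{a,b}$ does not depend on $a,b$). In particular, they have the same embedding dimension $\nu(R(I)_{a,b})=\nu(R)+\nu(I)$ and the same multiplicity.
   Context: All rings are commutative with unity. The Rees algebra of $R$ with respect to $I$ is $\mathcal R_+=\bigoplus_{n\ge 0} I^nt^n\subseteq R[t]$. For $a,b\in R$, let $(I^2(t^2+at+b))$ denote the ideal $(t^2+at+b)R[t]\cap \mathcal R_+$ of $\mathcal R_+$, and set $R(I)_{a,b}=\mathcal R_+/(I^2(t^2+at+b))$. Each element of $R(I)_{a,b}$ is uniquely represented by a polynomial $r+it$ with $r\in R$, $i\in I$; when $R$ is Noetherian local, $R(I)_{a,b}$ is Noetherian local. For a Noetherian local ring $(A,\mathfrak n)$, $\nu(J)$ is the cardinality of a minimal set of generators of an ideal $J$, the embedding dimension is $\nu(A)=\nu(\mathfrak n)$, and the Hilbert function is $H(n)=\lambda_A(\mathfrak n^n/\mathfrak n^{n+1})$, with $\lambda_A$ denoting length. *)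

theory Defs
  imports Complex_Main "HOL-Library.Extended_Nat" "HOL-Algebra.Ring_Divisibility"
    "HOL-Algebra.Ideal_Product" "HOL-Algebra.UnivPoly"
begin

section \<open>Noetherian local rings and their numerical invariants\<close>

locale noetherian_local_ring = cring + noetherian_ring +
  assumes unique_maximal: "\<exists>!M. maximalideal M R"

definition max_ideal :: "('a, 'm) ring_scheme \<Rightarrow> 'a set"
  where "max_ideal A = (THE M. maximalideal M A)"

abbreviation ideal_power :: "('a, 'm) ring_scheme \<Rightarrow> 'a set \<Rightarrow> nat \<Rightarrow> 'a set"
  where "ideal_power A J n \<equiv> J [^]\<^bsub>ideals_set A\<^esub> n"

text \<open>Minimality refers to the cardinality. A meaningful value requires \<open>J\<close> to be finitely
  generated; all uses below are in Noetherian rings.\<close>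

definition min_gens :: "('a, 'm) ring_scheme \<Rightarrow> 'a set \<Rightarrow> nat"
  where "min_gens A J =
    (LEAST n. \<exists>S \<subseteq> carrier A. finite S \<and> card S = n \<and> genideal A S = J)"

definition embedding_dim :: "('a, 'm) ring_scheme \<Rightarrow> nat"
  where "embedding_dim A = min_gens A (max_ideal A)"

text \<open>The supremum of all \<open>n\<close> such that there is a strict chain
  \<open>F 0 \<subset> F 1 \<subset> \<dots> \<subset> F n\<close> of members of \<open>\<S>\<close>.\<close>

definition chain_sup :: "'a set set \<Rightarrow> enat"
  where "chain_sup \<S> =
    (SUP n \<in> {n. \<exists>F. (\<forall>i\<le>n. F i \<in> \<S>) \<and> (\<forall>i<n. F i \<subset> F (Suc i))}. enat n)"

definition krull_dim :: "('a, 'm) ring_scheme \<Rightarrow> enat"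
  where "krull_dim A = chain_sup {P. primeideal P A}"

definition module_length :: "('a, 'm) ring_scheme \<Rightarrow> ('a, 'b, 'n) module_scheme \<Rightarrow> enat"
  where "module_length A M = chain_sup {N. submodule N A M}"

text \<open>The \<open>A\<close>-module \<open>J/K\<close> for ideals \<open>K \<subseteq> J\<close> of \<open>A\<close>. The record type \<open>module\<close> extends \<open>ring\<close>,
  so fields \<open>mult\<close> and \<open>one\<close> must be supplied, but they are not part of the module structure.\<close>

definition ideal_quot :: "('a, 'm) ring_scheme \<Rightarrow> 'a set \<Rightarrow> 'a set \<Rightarrow> ('a, 'a set) module"
  where "ideal_quot A J K =
    \<lparr>carrier = (\<lambda>x. K +>\<^bsub>A\<^esub> x) ` J,
     mult = rcoset_mult A K,
     one = K +>\<^bsub>A\<^esub> \<one>\<^bsub>A\<^esub>,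
     zero = K,
     add = set_add A,
     smult = (\<lambda>r C. \<Union>x\<in>C. K +>\<^bsub>A\<^esub> (r \<otimes>\<^bsub>A\<^esub> x))\<rparr>"

definition hilbert_fun :: "('a, 'm) ring_scheme \<Rightarrow> nat \<Rightarrow> enat"
  where "hilbert_fun A n = module_length A
    (ideal_quot A (ideal_power A (max_ideal A) n) (ideal_power A (max_ideal A) (Suc n)))"

text \<open>\<open>e(A) = lim d! \<lambda>(A/\<nn>\<^sup>k) / k\<^sup>d\<close> as \<open>k \<rightarrow> \<infinity>\<close>, where \<open>d = dim A\<close>. For a Noetherian local ring the
  limit exists, and the dimension and all lengths involved are finite.\<close>

definition multiplicity :: "('a, 'm) ring_scheme \<Rightarrow> real"
  where "multiplicity A =
    (let d = the_enat (krull_dim A) in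
     lim (\<lambda>k. fact d *
       real (the_enat (module_length A
         (ideal_quot A (carrier A) (ideal_power A (max_ideal A) k)))) / real k ^ d))"


section \<open>The rings \<open>R(I)\<^sub>a\<^sub>,\<^sub>b\<close>\<close>

definition rees_algebra :: "('a, 'm) ring_scheme \<Rightarrow> 'a set \<Rightarrow> ('a, nat \<Rightarrow> 'a) up_ring"
  where "rees_algebra R I = (UP R)
    \<lparr>carrier := {p \<in> carrier (UP R). \<forall>n. up_ring.coeff (UP R) p n \<in> ideal_power R I n}\<rparr>"

definition quad_poly :: "('a, 'm) ring_scheme \<Rightarrow> 'a \<Rightarrow> 'a \<Rightarrow> nat \<Rightarrow> 'a"
  where "quad_poly R a b =
    up_ring.monom (UP R) \<one>\<^bsub>R\<^esub> 2 \<oplus>\<^bsub>UP R\<^esub> up_ring.monom (UP R) a 1 \<oplus>\<^bsub>UP R\<^esub> up_ring.monom (UP R) b 0"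

definition rees_quot :: "('a, 'm) ring_scheme \<Rightarrow> 'a set \<Rightarrow> 'a \<Rightarrow> 'a \<Rightarrow> (nat \<Rightarrow> 'a) set ring"
  where "rees_quot R I a b = rees_algebra R I Quot
    (cgenideal (UP R) (quad_poly R a b) \<inter> carrier (rees_algebra R I))"

end

theory Submission
  imports Defs "HOL-Algebra.Subrings"
begin

text \<open>
  Write \<open>S = R(I)\<^sub>a\<^sub>,\<^sub>b\<close>. Division by the monic polynomial \<open>t\<^sup>2 + at + b\<close> shows that \<open>S = R + It\<close>, where each
  element is \<open>r + it\<close> for exactly one \<open>r \<in> R\<close> and \<open>i \<in> I\<close>, and \<open>t\<^sup>2 = -at - b\<close>
  (\<open>quadratic_extension_rees_quot\<close>). Only this description is used.

  The norm \<open>r\<^sup>2 - air + bi\<^sup>2\<close> of \<open>r + it\<close> is a unit if \<open>r \<notin> \<mm>\<close>, because \<open>I \<subseteq> \<mm>\<close>. So \<open>S\<close> is local with maximal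
  ideal \<open>\<nn> = \<mm> + It\<close>. In a product \<open>(r + it)(s + jt)\<close> the parameters enter only through \<open>aij\<close> and \<open>bij\<close>,
  and these terms are swallowed by the others: \<open>\<nn>\<^sup>k = \<mm>\<^sup>k + \<mm>\<^sup>k\<^sup>-\<^sup>1It\<close> for \<open>k \<ge> 1\<close> (\<open>\<nn>_power\<close>). As \<open>It \<subseteq> \<nn>\<close> acts as
  zero on \<open>\<nn>\<^sup>k/\<nn>\<^sup>k\<^sup>+\<^sup>1\<close>, its \<open>S\<close>-submodules are its \<open>R\<close>-submodules. They are the \<open>R\<close>-submodules of \<open>R \<times> I\<close> in an interval
  that does not depend on \<open>a\<close> and \<open>b\<close> (\<open>ideals_between_layers\<close>), and the same holds for the Hilbert function.

  For the embedding dimension, Nakayama's argument gives \<open>\<nu>(J) = \<lambda>(J/\<mm>J)\<close> for finitely generated ideals \<open>J\<close> of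
  a local ring (\<open>min_gens_eq_ideal_length\<close>). The additivity of length along
  \<open>\<nn>\<^sup>2 = \<mm>\<^sup>2 + \<mm>It \<subseteq> \<mm>\<^sup>2 + It \<subseteq> \<mm> + It = \<nn>\<close> then yields \<open>\<nu>(\<nn>) = \<nu>(I) + \<nu>(\<mm>)\<close>.

  The multiplicity is determined by the Krull dimension and the lengths of \<open>S/\<nn>\<^sup>k\<close>. The latter are sums of
  values of the Hilbert function, again by additivity. The Krull dimension of \<open>S\<close> is that of \<open>R\<close>
  (\<open>krull_dim_eq\<close>), since \<open>S\<close> is integral over \<open>R\<close>. Here every element is a root of a quadratic polynomial
  over \<open>R\<close> given by its trace and norm, which makes incomparability, lying over and going up short
  computations.

  Lengths are suprema of lengths of strict chains, so additivity is a statement about chains in a modular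
  lattice (\<open>chain_sup_le_add\<close>, \<open>chain_sup_add_le\<close>).
\<close>

section \<open>Chains of sets\<close>

definition strict_chain :: "'a set set \<Rightarrow> (nat \<Rightarrow> 'a set) \<Rightarrow> nat \<Rightarrow> bool"
  where "strict_chain \<S> F n \<longleftrightarrow> (\<forall>i\<le>n. F i \<in> \<S>) \<and> (\<forall>i<n. F i \<subset> F (Suc i))"

lemma chain_sup_le_iff: "chain_sup \<S> \<le> x \<longleftrightarrow> (\<forall>F n. strict_chain \<S> F n \<longrightarrow> enat n \<le> x)"
  unfolding chain_sup_def strict_chain_def by (auto simp: SUP_le_iff)

lemma strict_chain_le_chain_sup: "strict_chain \<S> F n \<Longrightarrow> enat n \<le> chain_sup \<S>"
  using chain_sup_le_iff by blast

text \<open>Longest chains are what can be joined in the additivity of length: in an interval, they must reach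
  both ends.\<close>

lemma chain_sup_attained:
  assumes "\<S> \<noteq> {}" "chain_sup \<S> \<noteq> \<infinity>"
  obtains F n where "strict_chain \<S> F n" "chain_sup \<S> = enat n"
proof -
  define L where "L = enat ` {n. \<exists>F. strict_chain \<S> F n}"
  have sup: "chain_sup \<S> = Sup L"
    unfolding chain_sup_def L_def strict_chain_def ..
  obtain X where "X \<in> \<S>" using assms(1) by blast
  then have "strict_chain \<S> (\<lambda>_. X) 0" by (simp add: strict_chain_def)
  then have ne: "L \<noteq> {}" by (auto simp: L_def)
  have fin: "finite L" using assms(2) ne unfolding sup Sup_enat_def by (auto split: if_splits)
  have "Sup L \<in> L" using ne fin Max_in unfolding Sup_enat_def by auto
  then show ?thesis using that by (auto simp: L_def sup)
qed

lemma chain_sup_mono_map: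
  assumes "\<And>X. X \<in> \<S> \<Longrightarrow> f X \<in> \<T>" "\<And>X Y. X \<in> \<S> \<Longrightarrow> Y \<in> \<S> \<Longrightarrow> X \<subset> Y \<Longrightarrow> f X \<subset> f Y"
  shows "chain_sup \<S> \<le> chain_sup \<T>"
  unfolding chain_sup_le_iff
proof (intro allI impI)
  fix F n assume "strict_chain \<S> F n"
  then have "strict_chain \<T> (\<lambda>i. f (F i)) n"
    using assms by (simp add: strict_chain_def Suc_leI less_imp_le)
  then show "enat n \<le> chain_sup \<T>" by (rule strict_chain_le_chain_sup)
qed

text \<open>Taking images under an injection is an isomorphism of inclusion orders.\<close>

lemma chain_sup_image_inj:
  assumes "inj_on f C" "\<And>X. X \<in> \<S> \<Longrightarrow> X \<subseteq> C"
  shows "chain_sup ((`) f ` \<S>) = chain_sup \<S>"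
proof (rule antisym)
  show "chain_sup ((`) f ` \<S>) \<le> chain_sup \<S>"
  proof (rule chain_sup_mono_map[where f = "\<lambda>Y. f -` Y \<inter> C"])
    have vim: "f -` (f ` X) \<inter> C = X" if "X \<in> \<S>" for X
      using assms(1) assms(2)[OF that] by (auto dest: inj_onD)
    show "f -` Y \<inter> C \<in> \<S>" if "Y \<in> (`) f ` \<S>" for Y
      using that vim by auto
    show "f -` Y \<inter> C \<subset> f -` Z \<inter> C" if "Y \<in> (`) f ` \<S>" "Z \<in> (`) f ` \<S>" "Y \<subset> Z" for Y Z
      using that vim by auto
  qed
  show "chain_sup \<S> \<le> chain_sup ((`) f ` \<S>)"
  proof (rule chain_sup_mono_map[where f = "(`) f"])
    show "f ` X \<subset> f ` Y" if "X \<in> \<S>" "Y \<in> \<S>" "X \<subset> Y" for X Y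
      using that assms(2) inj_on_image_eq_iff[OF assms(1), of X Y] by auto
  qed simp
qed

text \<open>The lattice-theoretic half of the additivity of length: if each inclusion that both \<open>f\<close> and \<open>g\<close>
  collapse is an equality, then each strict step of a chain survives under \<open>f\<close> or under \<open>g\<close>.
  In a modular lattice this applies to \<open>f X = X \<inter> B\<close> and \<open>g X = X + B\<close>.\<close>

lemma chain_sup_le_add:
  assumes "\<And>X. X \<in> \<S> \<Longrightarrow> f X \<in> \<T>" "\<And>X. X \<in> \<S> \<Longrightarrow> g X \<in> \<U>"
    and "\<And>X Y. X \<in> \<S> \<Longrightarrow> Y \<in> \<S> \<Longrightarrow> X \<subseteq> Y \<Longrightarrow> f X \<subseteq> f Y"
    and "\<And>X Y. X \<in> \<S> \<Longrightarrow> Y \<in> \<S> \<Longrightarrow> X \<subseteq> Y \<Longrightarrow> g X \<subseteq> g Y"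
    and "\<And>X Y. X \<in> \<S> \<Longrightarrow> Y \<in> \<S> \<Longrightarrow> X \<subseteq> Y \<Longrightarrow> f X = f Y \<Longrightarrow> g X = g Y \<Longrightarrow> X = Y"
  shows "chain_sup \<S> \<le> chain_sup \<T> + chain_sup \<U>"
  unfolding chain_sup_le_iff
proof (intro allI impI)
  fix F n assume chain: "strict_chain \<S> F n"
  have extend: "\<exists>G' m'. strict_chain \<T> G' m' \<and> G' m' = Z \<and> m' = (if G m = Z then m else Suc m)"
    if "strict_chain \<T> G m" "G m \<subseteq> Z" "Z \<in> \<T>" for \<T> :: "'x set set" and G m Z
  proof (cases "G m = Z")
    case False
    then have "strict_chain \<T> (G(Suc m := Z)) (Suc m)"
      using that by (auto simp: strict_chain_def le_Suc_eq less_Suc_eq)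
    then show ?thesis using False by (intro exI[of _ "G(Suc m := Z)"]) simp
  qed (use that in auto)
  have "\<exists>G1 n1 G2 n2. strict_chain \<T> G1 n1 \<and> G1 n1 = f (F k) \<and>
      strict_chain \<U> G2 n2 \<and> G2 n2 = g (F k) \<and> k \<le> n1 + n2" if "k \<le> n" for k
    using that
  proof (induction k)
    case 0
    then show ?case using chain assms(1,2)
      by (intro exI[of _ "\<lambda>_. f (F 0)"] exI[of _ "\<lambda>_. g (F 0)"] exI[of _ "0::nat"])
        (simp add: strict_chain_def)
  next
    case (Suc k)
    then obtain G1 n1 G2 n2 where IH: "strict_chain \<T> G1 n1" "G1 n1 = f (F k)"
      "strict_chain \<U> G2 n2" "G2 n2 = g (F k)" "k \<le> n1 + n2" by auto
    have F: "F k \<in> \<S>" "F (Suc k) \<in> \<S>" "F k \<subset> F (Suc k)"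
      using chain Suc.prems by (auto simp: strict_chain_def)
    obtain H1 m1 where H1: "strict_chain \<T> H1 m1" "H1 m1 = f (F (Suc k))"
        "m1 = (if f (F k) = f (F (Suc k)) then n1 else Suc n1)"
      using extend[OF IH(1), of "f (F (Suc k))"] IH(2) F assms by auto
    obtain H2 m2 where H2: "strict_chain \<U> H2 m2" "H2 m2 = g (F (Suc k))"
        "m2 = (if g (F k) = g (F (Suc k)) then n2 else Suc n2)"
      using extend[OF IH(3), of "g (F (Suc k))"] IH(4) F assms by auto
    have "Suc k \<le> m1 + m2" using H1(3) H2(3) IH(5) F assms(5)[OF F(1,2)] by (auto split: if_splits)
    then show ?case using H1 H2 by blast
  qed
  then obtain G1 n1 G2 n2 where "strict_chain \<T> G1 n1" "strict_chain \<U> G2 n2" "n \<le> n1 + n2"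
    by blast
  then have "enat n1 + enat n2 \<le> chain_sup \<T> + chain_sup \<U>"
    by (intro add_mono strict_chain_le_chain_sup)
  then show "enat n \<le> chain_sup \<T> + chain_sup \<U>"
    using \<open>n \<le> n1 + n2\<close> by (simp add: order_trans[rotated])
qed

text \<open>The other half: a longest chain below \<open>B\<close> must end at \<open>B\<close> and a longest chain above \<open>B\<close> must
  start there, as otherwise \<open>B\<close> could be added. So the two can be joined.\<close>

lemma chain_sup_add_le:
  assumes "B \<in> \<T>" "B \<in> \<U>" "\<T> \<subseteq> \<S>" "\<U> \<subseteq> \<S>"
    and "\<And>X. X \<in> \<T> \<Longrightarrow> X \<subseteq> B" "\<And>X. X \<in> \<U> \<Longrightarrow> B \<subseteq> X"
  shows "chain_sup \<T> + chain_sup \<U> \<le> chain_sup \<S>"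
proof (cases "chain_sup \<S> = \<infinity>")
  case False
  have "chain_sup \<T> \<le> chain_sup \<S>" "chain_sup \<U> \<le> chain_sup \<S>"
    using assms(3,4) by (auto intro!: chain_sup_mono_map[where f = "\<lambda>X. X"])
  then have fin: "chain_sup \<T> \<noteq> \<infinity>" "chain_sup \<U> \<noteq> \<infinity>"
    using False by (metis enat_ord_simps(5))+
  obtain F n where F: "strict_chain \<T> F n" "chain_sup \<T> = enat n"
    using chain_sup_attained[OF _ fin(1)] assms(1) by blast
  obtain G m where G: "strict_chain \<U> G m" "chain_sup \<U> = enat m"
    using chain_sup_attained[OF _ fin(2)] assms(2) by blast
  have FB: "F n = B"
  proof (rule ccontr)
    assume "F n \<noteq> B"
    then have "strict_chain \<T> (F(Suc n := B)) (Suc n)"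
      using F(1) assms(1,5) by (auto simp: strict_chain_def le_Suc_eq less_Suc_eq)
    from strict_chain_le_chain_sup[OF this] show False using F(2) by simp
  qed
  have GB: "G 0 = B"
  proof (rule ccontr)
    assume "G 0 \<noteq> B"
    then have "strict_chain \<U> (case_nat B G) (Suc m)"
      using G(1) assms(2,6) by (auto simp: strict_chain_def split: nat.split)
    from strict_chain_le_chain_sup[OF this] show False using G(2) by simp
  qed
  have "strict_chain \<S> (\<lambda>i. if i \<le> n then F i else G (i - n)) (n + m)"
    unfolding strict_chain_def
  proof (intro conjI allI impI)
    fix i assume "i \<le> n + m"
    then show "(if i \<le> n then F i else G (i - n)) \<in> \<S>"
      using F(1) G(1) assms(3,4) by (auto simp: strict_chain_def)
  next
    fix i assume i: "i < n + m"
    consider "i < n" | "i = n" | "i > n" by linarith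
    then show "(if i \<le> n then F i else G (i - n)) \<subset> (if Suc i \<le> n then F (Suc i) else G (Suc i - n))"
    proof cases
      case 2
      then have "F i = G 0" "G 0 \<subset> G (Suc 0)" using FB GB G(1) i by (auto simp: strict_chain_def)
      then show ?thesis using 2 by simp
    next
      case 3
      then have "G (i - n) \<subset> G (Suc (i - n))" using G(1) i by (simp add: strict_chain_def)
      then show ?thesis using 3 by (simp add: Suc_diff_le)
    qed (use F(1) in \<open>auto simp: strict_chain_def\<close>)
  qed
  from strict_chain_le_chain_sup[OF this] show ?thesis using F(2) G(2) by simp
qed simp

section \<open>Lengths of quotients of ideals\<close>

lemma (in cring) ideal_criterion:
  assumes "N \<subseteq> carrier R" "\<zero> \<in> N"
    and "\<And>x y. x \<in> N \<Longrightarrow> y \<in> N \<Longrightarrow> x \<oplus> y \<in> N"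
    and "\<And>r x. r \<in> carrier R \<Longrightarrow> x \<in> N \<Longrightarrow> r \<otimes> x \<in> N"
  shows "ideal N R"
proof (rule idealI[OF ring_axioms])
  have inv: "\<ominus> x \<in> N" if "x \<in> N" for x
  proof -
    have "x \<in> carrier R" using assms(1) that by blast
    then have "\<ominus> x = (\<ominus> \<one>) \<otimes> x" by algebra
    then show ?thesis using assms(4)[of "\<ominus> \<one>" x] that by simp
  qed
  show "subgroup N (add_monoid R)"
    using assms inv by (intro subgroup.intro) (auto simp: a_inv_def[symmetric])
  show "x \<otimes> a \<in> N" if "a \<in> N" "x \<in> carrier R" for a x using assms(4) that by blast
  show "a \<otimes> x \<in> N" if "a \<in> N" "x \<in> carrier R" for a x
    using assms(4)[OF that(2,1)] that assms(1) by (simp add: m_comm subset_iff)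
qed

lemma (in ring) ideal_minus_closed:
  assumes "ideal N R" "x \<in> N" "y \<in> N"
  shows "x \<ominus> y \<in> N"
proof -
  interpret N: ideal N R by fact
  show ?thesis using assms by (simp add: a_minus_def)
qed

text \<open>The length of the module \<open>J/K\<close>, expressed by ideals of the ring instead of sets of cosets.\<close>

definition ideal_length :: "('a, 'm) ring_scheme \<Rightarrow> 'a set \<Rightarrow> 'a set \<Rightarrow> enat"
  where "ideal_length A K J = chain_sup {N. ideal N A \<and> K \<subseteq> N \<and> N \<subseteq> J}"

text \<open>Modularity of the lattice of ideals: \<open>X \<subseteq> Y\<close> with \<open>X \<inter> L = Y \<inter> L\<close> and \<open>X + L = Y + L\<close> forces
  \<open>X = Y\<close>.\<close>

lemma (in cring) ideal_length_add:
  assumes K: "ideal K R" and L: "ideal L R" and J: "ideal J R" and KL: "K \<subseteq> L" and LJ: "L \<subseteq> J"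
  shows "ideal_length R K J = ideal_length R K L + ideal_length R L J"
proof (rule antisym)
  interpret L: ideal L R by fact
  interpret J: ideal J R by fact
  show "ideal_length R K J \<le> ideal_length R K L + ideal_length R L J"
    unfolding ideal_length_def
  proof (rule chain_sup_le_add[where f = "\<lambda>X. X \<inter> L" and g = "\<lambda>X. set_add R X L"])
    fix X assume X: "X \<in> {N. ideal N R \<and> K \<subseteq> N \<and> N \<subseteq> J}"
    then interpret X: ideal X R by simp
    show "X \<inter> L \<in> {N. ideal N R \<and> K \<subseteq> N \<and> N \<subseteq> L}"
      using X KL L by (auto intro: i_intersect)
    have "L \<subseteq> set_add R X L"
    proof
      fix l assume "l \<in> L"
      then have "\<zero> \<oplus> l \<in> set_add R X L" unfolding set_add_def' using X.zero_closed by blast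
      then show "l \<in> set_add R X L" using \<open>l \<in> L\<close> L.a_Hcarr by simp
    qed
    moreover have "set_add R X L \<subseteq> J" using X LJ by (auto simp: set_add_def' subset_iff)
    ultimately show "set_add R X L \<in> {N. ideal N R \<and> L \<subseteq> N \<and> N \<subseteq> J}"
      using X L add_ideals by auto
  next
    fix X Y assume X: "X \<in> {N. ideal N R \<and> K \<subseteq> N \<and> N \<subseteq> J}"
      and Y: "Y \<in> {N. ideal N R \<and> K \<subseteq> N \<and> N \<subseteq> J}" and XY: "X \<subseteq> Y"
    then interpret X: ideal X R by simp
    interpret Y: ideal Y R using Y by simp
    show "X \<inter> L \<subseteq> Y \<inter> L" using XY by auto
    show "set_add R X L \<subseteq> set_add R Y L" using XY by (auto simp: set_add_def')
    assume eq: "X \<inter> L = Y \<inter> L" "set_add R X L = set_add R Y L"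
    show "X = Y"
    proof (rule antisym[OF XY subsetI])
      fix y assume y: "y \<in> Y"
      have "y \<oplus> \<zero> \<in> set_add R Y L" unfolding set_add_def' using y L.zero_closed by blast
      then have "y \<in> set_add R X L" using eq(2) y by simp
      then obtain x l where xl: "x \<in> X" "l \<in> L" "y = x \<oplus> l" unfolding set_add_def' by blast
      have "l = y \<ominus> x" using xl X.a_Hcarr L.a_Hcarr by algebra
      then have "l \<in> Y" using y xl(1) XY ideal_minus_closed[of Y y x] Y.is_ideal by auto
      then have "l \<in> X" using xl(2) eq(1) by auto
      then show "y \<in> X" using xl by simp
    qed
  qed
  show "ideal_length R K L + ideal_length R L J \<le> ideal_length R K J"
    unfolding ideal_length_def
    by (rule chain_sup_add_le[where B = L]) (use assms in auto)
qed

lemma ideal_length_self: "ideal_length A K K = 0"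
proof -
  have "ideal_length A K K \<le> 0"
    unfolding ideal_length_def chain_sup_le_iff strict_chain_def
  proof (intro allI impI)
    fix F and n :: nat
    assume *: "(\<forall>i\<le>n. F i \<in> {N. ideal N A \<and> K \<subseteq> N \<and> N \<subseteq> K}) \<and> (\<forall>i<n. F i \<subset> F (Suc i))"
    show "enat n \<le> 0"
    proof (cases n)
      case (Suc k)
      then have "F 0 = K" "F (Suc 0) = K" "F 0 \<subset> F (Suc 0)" using * by (auto simp: Suc_le_eq)
      then show ?thesis by simp
    qed (simp add: zero_enat_def)
  qed
  then show ?thesis by simp
qed

context cring
begin

lemma ideal_quot_coset_eq_iff:
  assumes "ideal K R" "x \<in> carrier R" "y \<in> carrier R"
  shows "K +> x = K +> y \<longleftrightarrow> x \<ominus> y \<in> K"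
  using quotient_eq_iff_same_a_r_cos[OF assms] by blast

lemma ideal_quot_smult:
  assumes "ideal K R" "r \<in> carrier R" "x \<in> carrier R"
  shows "r \<odot>\<^bsub>ideal_quot R J K\<^esub> (K +> x) = K +> (r \<otimes> x)"
proof -
  interpret K: ideal K R by fact
  have x: "x \<in> K +> x" using assms(3) by (rule K.a_rcos_self)
  have eq: "K +> (r \<otimes> y) = K +> (r \<otimes> x)" if y: "y \<in> K +> x" for y
  proof -
    obtain k where k: "k \<in> K" "y = k \<oplus> x" using y by (auto simp: a_r_coset_def')
    have "r \<otimes> y \<ominus> r \<otimes> x = r \<otimes> k"
      using K.a_Hcarr[OF k(1)] assms(2,3)
      by (simp add: k(2) r_distr a_minus_def a_assoc r_neg)
    moreover have "r \<otimes> k \<in> K" using assms(2) k(1) by (rule K.I_l_closed[rotated])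
    ultimately show ?thesis using ideal_quot_coset_eq_iff[OF assms(1)] k K.a_Hcarr[OF k(1)] assms by simp
  qed
  have "(\<Union>y\<in>K +> x. K +> (r \<otimes> y)) = K +> (r \<otimes> x)"
    by (rule SUP_eq_const) (use x in blast, erule eq)
  then show ?thesis by (simp add: ideal_quot_def)
qed

lemma ideal_quot_inv:
  assumes K: "ideal K R" and J: "ideal J R" and x: "x \<in> J"
  shows "inv\<^bsub>add_monoid (ideal_quot R J K)\<^esub> (K +> x) = K +> (\<ominus> x)"
proof -
  interpret K: ideal K R by fact
  interpret J: ideal J R by fact
  have xc: "x \<in> carrier R" using x by (rule J.a_Hcarr)
  have K0: "K +> \<zero> = K" by (rule a_rcos_zero[OF K K.zero_closed])
  show ?thesis
    unfolding m_inv_def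
  proof (rule the_equality)
    show "K +> \<ominus> x \<in> carrier (add_monoid (ideal_quot R J K)) \<and>
      (K +> x) \<otimes>\<^bsub>add_monoid (ideal_quot R J K)\<^esub> (K +> \<ominus> x) = \<one>\<^bsub>add_monoid (ideal_quot R J K)\<^esub> \<and>
      (K +> \<ominus> x) \<otimes>\<^bsub>add_monoid (ideal_quot R J K)\<^esub> (K +> x) = \<one>\<^bsub>add_monoid (ideal_quot R J K)\<^esub>"
      using x xc K0 by (simp add: ideal_quot_def K.a_rcos_sum r_neg l_neg)
  next
    fix C assume C: "C \<in> carrier (add_monoid (ideal_quot R J K)) \<and>
      (K +> x) \<otimes>\<^bsub>add_monoid (ideal_quot R J K)\<^esub> C = \<one>\<^bsub>add_monoid (ideal_quot R J K)\<^esub> \<and>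
      C \<otimes>\<^bsub>add_monoid (ideal_quot R J K)\<^esub> (K +> x) = \<one>\<^bsub>add_monoid (ideal_quot R J K)\<^esub>"
    then obtain z where z: "z \<in> J" "C = K +> z" by (auto simp: ideal_quot_def)
    have zc: "z \<in> carrier R" using z(1) by (rule J.a_Hcarr)
    have "K +> (x \<oplus> z) = K +> \<zero>"
      using C xc zc K0 by (simp add: ideal_quot_def z(2) K.a_rcos_sum)
    then have "x \<oplus> z \<ominus> \<zero> \<in> K" using ideal_quot_coset_eq_iff[OF K] xc zc by simp
    moreover have "x \<oplus> z \<ominus> \<zero> = z \<ominus> (\<ominus> x)" using xc zc by algebra
    ultimately show "C = K +> \<ominus> x" using ideal_quot_coset_eq_iff[OF K] xc zc z(2) by simp
  qed
qed

lemma submodule_ideal_quot_image: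
  assumes K: "ideal K R" and J: "ideal J R" and N: "ideal N R" "K \<subseteq> N" "N \<subseteq> J"
  shows "submodule ((+>) K ` N) R (ideal_quot R J K)"
proof -
  interpret K: ideal K R by fact
  interpret J: ideal J R by fact
  interpret N: ideal N R by fact
  have K0: "K +> \<zero> = K" by (rule a_rcos_zero[OF K K.zero_closed])
  show ?thesis
  proof (intro submodule.intro subgroup.intro submodule_axioms.intro)
    show "(+>) K ` N \<subseteq> carrier (add_monoid (ideal_quot R J K))"
      using N(3) by (auto simp: ideal_quot_def)
    show "\<one>\<^bsub>add_monoid (ideal_quot R J K)\<^esub> \<in> (+>) K ` N"
      using K0 N.zero_closed by (auto simp: ideal_quot_def intro!: image_eqI[of _ _ \<zero>])
    show "C \<otimes>\<^bsub>add_monoid (ideal_quot R J K)\<^esub> D \<in> (+>) K ` N"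
      if "C \<in> (+>) K ` N" "D \<in> (+>) K ` N" for C D
      using that by (auto simp: ideal_quot_def K.a_rcos_sum)
    show "inv\<^bsub>add_monoid (ideal_quot R J K)\<^esub> C \<in> (+>) K ` N" if "C \<in> (+>) K ` N" for C
      using that N(3) by (auto simp: ideal_quot_inv[OF K J] subset_iff)
    show "r \<odot>\<^bsub>ideal_quot R J K\<^esub> C \<in> (+>) K ` N"
      if "r \<in> carrier R" "C \<in> (+>) K ` N" for r C
      using that by (auto simp: ideal_quot_smult[OF K] N.I_l_closed)
  qed
qed

lemma ideal_of_submodule_ideal_quot:
  assumes K: "ideal K R" and J: "ideal J R" "K \<subseteq> J" and H: "submodule H R (ideal_quot R J K)"
  shows "ideal {x \<in> J. K +> x \<in> H} R" "K \<subseteq> {x \<in> J. K +> x \<in> H}"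
    and "(+>) K ` {x \<in> J. K +> x \<in> H} = H"
proof -
  interpret K: ideal K R by fact
  interpret J: ideal J R by fact
  interpret H: submodule H R "ideal_quot R J K" by fact
  have K0: "K \<in> H" using H.one_closed by (simp add: ideal_quot_def)
  show "ideal {x \<in> J. K +> x \<in> H} R"
  proof (rule ideal_criterion)
    show "\<zero> \<in> {x \<in> J. K +> x \<in> H}" using K0 a_rcos_zero[OF K K.zero_closed] by simp
    show "x \<oplus> y \<in> {x \<in> J. K +> x \<in> H}" if "x \<in> {x \<in> J. K +> x \<in> H}" "y \<in> {x \<in> J. K +> x \<in> H}" for x y
      using that H.m_closed[of "K +> x" "K +> y"] by (simp add: ideal_quot_def K.a_rcos_sum)
    show "r \<otimes> x \<in> {x \<in> J. K +> x \<in> H}" if "r \<in> carrier R" "x \<in> {x \<in> J. K +> x \<in> H}" for r x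
      using that H.smult_closed[of r "K +> x"] by (simp add: ideal_quot_smult[OF K] J.I_l_closed)
  qed auto
  show "K \<subseteq> {x \<in> J. K +> x \<in> H}" using J(2) K0 a_rcos_zero[OF K] by auto
  show "(+>) K ` {x \<in> J. K +> x \<in> H} = H"
    using H.subset by (auto simp: ideal_quot_def)
qed

text \<open>The correspondence between submodules of \<open>J/K\<close> and ideals between \<open>K\<close> and \<open>J\<close>.\<close>

lemma module_length_ideal_quot:
  assumes K: "ideal K R" and J: "ideal J R" and KJ: "K \<subseteq> J"
  shows "module_length R (ideal_quot R J K) = ideal_length R K J"
proof (rule antisym)
  show "module_length R (ideal_quot R J K) \<le> ideal_length R K J"
    unfolding module_length_def ideal_length_def
  proof (rule chain_sup_mono_map[where f = "\<lambda>H. {x \<in> J. K +> x \<in> H}"])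
    show "{x \<in> J. K +> x \<in> H} \<in> {N. ideal N R \<and> K \<subseteq> N \<and> N \<subseteq> J}"
      if "H \<in> {H. submodule H R (ideal_quot R J K)}" for H
      using ideal_of_submodule_ideal_quot[OF K J KJ, of H] that by auto
    show "{x \<in> J. K +> x \<in> H} \<subset> {x \<in> J. K +> x \<in> H'}"
      if "H \<in> {H. submodule H R (ideal_quot R J K)}" "H' \<in> {H. submodule H R (ideal_quot R J K)}"
        "H \<subset> H'" for H H'
    proof
      show "{x \<in> J. K +> x \<in> H} \<subseteq> {x \<in> J. K +> x \<in> H'}" using that(3) by blast
      have "(+>) K ` {x \<in> J. K +> x \<in> H} = H" "(+>) K ` {x \<in> J. K +> x \<in> H'} = H'"
        using ideal_of_submodule_ideal_quot(3)[OF K J KJ] that(1,2) by simp_all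
      then show "{x \<in> J. K +> x \<in> H} \<noteq> {x \<in> J. K +> x \<in> H'}" using that(3) by (metis less_irrefl)
    qed
  qed
  show "ideal_length R K J \<le> module_length R (ideal_quot R J K)"
    unfolding module_length_def ideal_length_def
  proof (rule chain_sup_mono_map[where f = "(`) ((+>) K)"])
    show "(+>) K ` N \<in> {H. submodule H R (ideal_quot R J K)}"
      if "N \<in> {N. ideal N R \<and> K \<subseteq> N \<and> N \<subseteq> J}" for N
      using submodule_ideal_quot_image[OF K J, of N] that by blast
    fix N N' assume N: "N \<in> {N. ideal N R \<and> K \<subseteq> N \<and> N \<subseteq> J}"
      and N': "N' \<in> {N. ideal N R \<and> K \<subseteq> N \<and> N \<subseteq> J}" and sub: "N \<subset> N'"
    interpret N: ideal N R using N by simp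
    interpret N': ideal N' R using N' by simp
    obtain x where x: "x \<in> N'" "x \<notin> N" using sub by blast
    have "K +> x \<notin> (+>) K ` N"
    proof
      assume "K +> x \<in> (+>) K ` N"
      then obtain y where y: "y \<in> N" "K +> x = K +> y" by blast
      have c: "x \<in> carrier R" "y \<in> carrier R" using x y by auto
      then have "x \<ominus> y \<in> N" using y(2) ideal_quot_coset_eq_iff[OF K] N by auto
      then have "(x \<ominus> y) \<oplus> y \<in> N" using y(1) by simp
      moreover have "(x \<ominus> y) \<oplus> y = x" using c by algebra
      ultimately show False using x(2) by simp
    qed
    then show "(+>) K ` N \<subset> (+>) K ` N'" using sub x(1) by blast
  qed
qed

end

section \<open>Ideals avoiding a set\<close>

lemma (in ring) ex_ideal_maximal_avoiding:
  assumes "ideal J R" "J \<inter> T = {}"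
  obtains Q where "ideal Q R" "J \<subseteq> Q" "Q \<inter> T = {}"
    "\<And>Q'. ideal Q' R \<Longrightarrow> Q \<subseteq> Q' \<Longrightarrow> Q' \<inter> T = {} \<Longrightarrow> Q' = Q"
proof -
  let ?A = "{Q. ideal Q R \<and> J \<subseteq> Q \<and> Q \<inter> T = {}}"
  have "\<exists>M\<in>?A. \<forall>X\<in>?A. M \<subseteq> X \<longrightarrow> X = M"
  proof (rule subset_Zorn_nonempty)
    show "?A \<noteq> {}" using assms by blast
    fix C assume ne: "C \<noteq> {}" and C: "subset.chain ?A C"
    then have "subset.chain {I. ideal I R} C" unfolding subset_chain_def by blast
    then have "ideal (\<Union>C) R" using chain_Union_is_ideal[of C] ne by simp
    then show "\<Union>C \<in> ?A" using C ne unfolding subset_chain_def by blast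
  qed
  then obtain Q where "Q \<in> ?A" "\<forall>X\<in>?A. Q \<subseteq> X \<longrightarrow> X = Q" by blast
  then show thesis using that[of Q] by auto
qed

text \<open>By maximality, \<open>Q + (x)\<close> meets \<open>T\<close>.\<close>

lemma (in cring) maximal_avoiding_meets:
  assumes Q: "ideal Q R" and max: "\<And>Q'. ideal Q' R \<Longrightarrow> Q \<subseteq> Q' \<Longrightarrow> Q' \<inter> T = {} \<Longrightarrow> Q' = Q"
    and x: "x \<in> carrier R" "x \<notin> Q"
  obtains q r where "q \<in> Q" "r \<in> carrier R" "q \<oplus> r \<otimes> x \<in> T"
proof -
  interpret Q: ideal Q R by fact
  let ?Q' = "set_add R Q (PIdl x)"
  have id: "ideal ?Q' R" using add_ideals[OF Q cgenideal_ideal[OF x(1)]] .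
  have "q \<oplus> \<zero> \<otimes> x \<in> ?Q'" if "q \<in> Q" for q
    unfolding set_add_def' cgenideal_def using that by blast
  then have sub: "Q \<subseteq> ?Q'" using x(1) Q.a_Hcarr by auto
  have "\<zero> \<oplus> \<one> \<otimes> x \<in> ?Q'" unfolding set_add_def' cgenideal_def using Q.zero_closed by blast
  then have "?Q' \<noteq> Q" using x by auto
  then obtain t where "t \<in> ?Q'" "t \<in> T" using max[OF id sub] by blast
  then show thesis using that unfolding set_add_def' cgenideal_def by blast
qed

text \<open>If neither \<open>x\<close> nor \<open>y\<close> lies in \<open>Q\<close>, then the product of an element of \<open>(Q + (x)) \<inter> T\<close> with one of
  \<open>(Q + (y)) \<inter> T\<close> lies in \<open>T\<close>, and in \<open>Q + (xy)\<close>.\<close>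

lemma (in cring) maximal_avoiding_primeideal:
  assumes Q: "ideal Q R" and avoid: "Q \<inter> T = {}"
    and max: "\<And>Q'. ideal Q' R \<Longrightarrow> Q \<subseteq> Q' \<Longrightarrow> Q' \<inter> T = {} \<Longrightarrow> Q' = Q"
    and T: "\<one> \<in> T" "\<And>s t. s \<in> T \<Longrightarrow> t \<in> T \<Longrightarrow> s \<otimes> t \<in> T"
  shows "primeideal Q R"
proof (rule primeidealI[OF Q is_cring])
  interpret Q: ideal Q R by fact
  show "carrier R \<noteq> Q" using T(1) avoid by auto
  fix x y assume x: "x \<in> carrier R" and y: "y \<in> carrier R" and xy: "x \<otimes> y \<in> Q"
  show "x \<in> Q \<or> y \<in> Q"
  proof (rule ccontr)
    assume n: "\<not> (x \<in> Q \<or> y \<in> Q)"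
    obtain q r where qr: "q \<in> Q" "r \<in> carrier R" "q \<oplus> r \<otimes> x \<in> T"
      using maximal_avoiding_meets[OF Q max x] n by blast
    obtain q' r' where qr': "q' \<in> Q" "r' \<in> carrier R" "q' \<oplus> r' \<otimes> y \<in> T"
      using maximal_avoiding_meets[OF Q max y] n by blast
    have c: "q \<in> carrier R" "q' \<in> carrier R" using qr qr' by auto
    have "(q \<oplus> r \<otimes> x) \<otimes> (q' \<oplus> r' \<otimes> y) =
        (q' \<oplus> r' \<otimes> y) \<otimes> q \<oplus> ((r \<otimes> x) \<otimes> q' \<oplus> (r \<otimes> r') \<otimes> (x \<otimes> y))"
      using c qr(2) qr'(2) x y by algebra
    also have "\<dots> \<in> Q"
      using Q.I_l_closed[OF qr(1), of "q' \<oplus> r' \<otimes> y"] Q.I_l_closed[OF qr'(1), of "r \<otimes> x"]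
        Q.I_l_closed[OF xy, of "r \<otimes> r'"] c qr(2) qr'(2) x y
      by (intro Q.a_closed) simp_all
    finally show False using T(2)[OF qr(3) qr'(3)] avoid by blast
  qed
qed

section \<open>Minimal generators in local rings\<close>

text \<open>A local ring is given here by an ideal outside of which all elements are units. For the rings
  \<open>R + It\<close> this is the property that a norm computation yields directly.\<close>

locale local_cring = cring R for R (structure) +
  fixes \<mm> :: "'a set"
  assumes \<mm>_ideal: "ideal \<mm> R" and one_notin_\<mm>: "\<one> \<notin> \<mm>"
    and Units_if_notin_\<mm>: "x \<in> carrier R \<Longrightarrow> x \<notin> \<mm> \<Longrightarrow> x \<in> Units R"

lemma (in cring) ideal_eq_carrier_if_unit:
  assumes "ideal J R" "x \<in> J" "x \<in> Units R"
  shows "J = carrier R"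
proof -
  interpret J: ideal J R by fact
  have "inv x \<otimes> x \<in> J" using assms by (intro J.I_l_closed) auto
  then show ?thesis using assms(3) J.one_imp_carrier by simp
qed

lemma (in local_cring) max_ideal_eq: "max_ideal R = \<mm>"
  unfolding max_ideal_def
proof (rule the_equality)
  interpret m: ideal \<mm> R by (rule \<mm>_ideal)
  have proper: "J \<subseteq> \<mm>" if J: "ideal J R" "J \<noteq> carrier R" for J
  proof
    fix x assume x: "x \<in> J"
    then have "x \<in> carrier R" using J(1) by (simp add: ideal.Icarr)
    then show "x \<in> \<mm>" using x J ideal_eq_carrier_if_unit Units_if_notin_\<mm> by blast
  qed
  have ne: "carrier R \<noteq> \<mm>" using one_notin_\<mm> by auto
  show "maximalideal \<mm> R"
  proof (rule maximalidealI[OF \<mm>_ideal ne])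
    show "J = \<mm> \<or> J = carrier R" if "ideal J R" "\<mm> \<subseteq> J" "J \<subseteq> carrier R" for J
      using proper[OF that(1)] that by blast
  qed
  show "M = \<mm>" if "maximalideal M R" for M
  proof -
    interpret M: maximalideal M R by fact
    show ?thesis
      using proper[OF M.is_ideal] M.I_maximal[OF \<mm>_ideal] M.I_notcarr ne m.a_subset by blast
  qed
qed

lemma (in noetherian_local_ring) local_cring_max_ideal: "local_cring R (max_ideal R)"
proof (intro local_cring.intro local_cring_axioms.intro is_cring)
  have "maximalideal (max_ideal R) R"
    unfolding max_ideal_def using unique_maximal by (rule theI')
  then interpret m: maximalideal "max_ideal R" R .
  show "ideal (max_ideal R) R" by (rule m.is_ideal)
  show "\<one> \<notin> max_ideal R" using m.one_imp_carrier m.I_notcarr by auto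
  fix x assume x: "x \<in> carrier R" "x \<notin> max_ideal R"
  show "x \<in> Units R"
  proof (rule ccontr)
    assume nu: "x \<notin> Units R"
    \<comment> \<open>Ideals avoiding \<open>{\<one>}\<close> are the proper ideals, so a nonunit lies in a maximal ideal.\<close>
    have "PIdl x \<inter> {\<one>} = {}"
    proof (rule ccontr)
      assume "PIdl x \<inter> {\<one>} \<noteq> {}"
      then obtain y where y: "y \<in> carrier R" "y \<otimes> x = \<one>" unfolding cgenideal_def by force
      then have "x \<otimes> y = \<one>" using m_comm[OF x(1) y(1)] by simp
      then have "x \<in> Units R" using y x(1) unfolding Units_def by blast
      then show False using nu by simp
    qed
    then obtain Q where Q: "ideal Q R" "PIdl x \<subseteq> Q" "Q \<inter> {\<one>} = {}"
      and max: "\<And>Q'. ideal Q' R \<Longrightarrow> Q \<subseteq> Q' \<Longrightarrow> Q' \<inter> {\<one>} = {} \<Longrightarrow> Q' = Q"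
      using ex_ideal_maximal_avoiding[OF cgenideal_ideal[OF x(1)]] by metis
    have "maximalideal Q R"
    proof (rule maximalidealI[OF Q(1)])
      show "carrier R \<noteq> Q" using Q(3) by auto
      show "J = Q \<or> J = carrier R" if "ideal J R" "Q \<subseteq> J" "J \<subseteq> carrier R" for J
        using max[OF that(1,2)] ideal.one_imp_carrier[OF that(1)] by blast
    qed
    then have "Q = max_ideal R" using m.is_maximalideal unique_maximal by blast
    then show False using x Q(2) cgenideal_self by blast
  qed
qed

lemma ideal_length_pos:
  assumes "ideal L A" "ideal J A" "L \<subset> J"
  shows "1 \<le> ideal_length A L J"
proof -
  have "strict_chain {N. ideal N A \<and> L \<subseteq> N \<and> N \<subseteq> J} (\<lambda>i. if i = 0 then L else J) 1"
    using assms by (auto simp: strict_chain_def)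
  from strict_chain_le_chain_sup[OF this] show ?thesis
    by (simp add: ideal_length_def one_enat_def)
qed

context cring
begin

lemma genideal_insert_subset:
  assumes "ideal L R" "g \<in> carrier R" "A \<subseteq> L" "x \<in> Idl (insert g A)"
  obtains l r where "l \<in> L" "r \<in> carrier R" "x = l \<oplus> r \<otimes> g"
proof -
  interpret L: ideal L R by fact
  let ?S = "set_add R L (PIdl g)"
  have "ideal ?S R" using add_ideals[OF assms(1) cgenideal_ideal[OF assms(2)]] .
  moreover have "insert g A \<subseteq> ?S"
  proof -
    have "\<zero> \<oplus> \<one> \<otimes> g \<in> ?S" unfolding set_add_def' cgenideal_def using L.zero_closed by blast
    moreover have "a \<oplus> \<zero> \<otimes> g \<in> ?S" if "a \<in> A" for a
      unfolding set_add_def' cgenideal_def using that assms(3) by blast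
    ultimately show ?thesis using assms(2,3) L.a_subset by (auto simp: subset_iff)
  qed
  ultimately have "x \<in> ?S" using genideal_minimal assms(4) by blast
  then show thesis using that unfolding set_add_def' cgenideal_def by blast
qed

lemma ideal_genideal_Un: "ideal K R \<Longrightarrow> G \<subseteq> carrier R \<Longrightarrow> ideal (Idl (K \<union> G)) R"
  using additive_subgroup.a_subset[OF ideal.axioms(1)] by (intro genideal_ideal) auto

lemma Un_subset_genideal: "ideal K R \<Longrightarrow> G \<subseteq> carrier R \<Longrightarrow> K \<union> G \<subseteq> Idl (K \<union> G)"
  using additive_subgroup.a_subset[OF ideal.axioms(1)] by (intro genideal_self) auto

lemma ideal_length_genideal_insert:
  assumes K: "ideal K R" and G: "insert g G \<subseteq> carrier R"
  shows "ideal_length R K (Idl (K \<union> insert g G)) =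
    ideal_length R K (Idl (K \<union> G)) + ideal_length R (Idl (K \<union> G)) (Idl (K \<union> insert g G))"
proof (rule ideal_length_add[OF K])
  have G': "G \<subseteq> carrier R" using G by auto
  show "ideal (Idl (K \<union> G)) R" by (rule ideal_genideal_Un[OF K G'])
  show "ideal (Idl (K \<union> insert g G)) R" by (rule ideal_genideal_Un[OF K G])
  show "K \<subseteq> Idl (K \<union> G)" using Un_subset_genideal[OF K G'] by blast
  show "Idl (K \<union> G) \<subseteq> Idl (K \<union> insert g G)"
    using Un_subset_genideal[OF K G] ideal_genideal_Un[OF K G] by (intro genideal_minimal) auto
qed

end

context local_cring
begin

text \<open>Since \<open>\<mm>g \<subseteq> L\<close>, the module \<open>(L + (g))/L\<close> is a quotient of the residue field. In terms of ideals: one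
  strictly above \<open>L\<close> inside \<open>J\<close> contains some \<open>l + rg\<close> with \<open>r \<notin> \<mm>\<close>, so \<open>r\<close> is a unit, and it contains \<open>g\<close>
  and all of \<open>J\<close>.\<close>

lemma ideal_length_le_1:
  assumes L: "ideal L R" and g: "g \<in> carrier R" "\<And>r. r \<in> \<mm> \<Longrightarrow> r \<otimes> g \<in> L"
    and J: "\<And>x. x \<in> J \<Longrightarrow> \<exists>l\<in>L. \<exists>r\<in>carrier R. x = l \<oplus> r \<otimes> g"
  shows "ideal_length R L J \<le> 1"
  unfolding ideal_length_def chain_sup_le_iff
proof (intro allI impI)
  interpret L: ideal L R by fact
  have dich: "J \<subseteq> N" if N: "ideal N R" "L \<subset> N" "N \<subseteq> J" for N
  proof -
    interpret N: ideal N R by fact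
    obtain x where x: "x \<in> N" "x \<notin> L" using N(2) by blast
    then obtain l r where lr: "l \<in> L" "r \<in> carrier R" "x = l \<oplus> r \<otimes> g" using J N(3) by blast
    have "r \<notin> \<mm>" using lr x(2) g(2) by auto
    then have r: "r \<in> Units R" using lr(2) Units_if_notin_\<mm> by blast
    have "r \<otimes> g = x \<ominus> l" using lr g(1) L.a_Hcarr[OF lr(1)] by algebra
    then have "r \<otimes> g \<in> N" using ideal_minus_closed[OF N(1) x(1)] lr(1) N(2) by auto
    then have "inv r \<otimes> (r \<otimes> g) \<in> N" using r by (rule N.I_l_closed[OF _ Units_inv_closed])
    moreover have "inv r \<otimes> (r \<otimes> g) = g" using r g(1) lr(2) by (simp add: m_assoc[symmetric])
    ultimately have gN: "g \<in> N" by metis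
    show "J \<subseteq> N"
    proof
      fix y assume "y \<in> J"
      then obtain l r where "l \<in> L" "r \<in> carrier R" "y = l \<oplus> r \<otimes> g" using J by blast
      then show "y \<in> N" using N(2) gN by (auto intro!: N.a_closed N.I_l_closed)
    qed
  qed
  fix F and n :: nat
  assume F: "strict_chain {N. ideal N R \<and> L \<subseteq> N \<and> N \<subseteq> J} F n"
  show "enat n \<le> 1"
  proof (rule ccontr)
    assume "\<not> enat n \<le> 1"
    then have "Suc 1 \<le> n" by (simp add: one_enat_def)
    then have "F 0 \<subset> F 1" "F 1 \<subset> F 2" "ideal (F 1) R" "L \<subseteq> F 0" "F 1 \<subseteq> J" "F 2 \<subseteq> J"
      using F by (auto simp: strict_chain_def numeral_2_eq_2)
    then show False using dich[of "F 1"] by blast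
  qed
qed

lemma ideal_length_genideal_le_card:
  assumes K: "ideal K R" and G: "finite G" "G \<subseteq> carrier R"
    and mG: "\<And>r g. r \<in> \<mm> \<Longrightarrow> g \<in> G \<Longrightarrow> r \<otimes> g \<in> K"
  shows "ideal_length R K (Idl (K \<union> G)) \<le> enat (card G)"
  using G mG
proof (induction G rule: finite_induct)
  case empty
  have "Idl K = K" using genideal_self[of K] genideal_minimal[OF K, of K] ideal.axioms(1)[OF K]
    by (auto dest: additive_subgroup.a_subset)
  then show ?case using ideal_length_self[of R K] by (simp add: zero_enat_def)
next
  case (insert g G)
  have G': "G \<subseteq> carrier R" and g: "g \<in> carrier R" using insert.prems(1) by auto
  have L: "ideal (Idl (K \<union> G)) R" using ideal_genideal_Un[OF K G'] .
  have sub: "K \<union> G \<subseteq> Idl (K \<union> G)" using Un_subset_genideal[OF K G'] .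
  have "ideal_length R (Idl (K \<union> G)) (Idl (K \<union> insert g G)) \<le> 1"
  proof (rule ideal_length_le_1[OF L g])
    show "r \<otimes> g \<in> Idl (K \<union> G)" if "r \<in> \<mm>" for r using insert.prems(2)[OF that] sub by auto
    show "\<exists>l\<in>Idl (K \<union> G). \<exists>r\<in>carrier R. x = l \<oplus> r \<otimes> g" if "x \<in> Idl (K \<union> insert g G)" for x
    proof -
      have "x \<in> Idl (insert g (K \<union> G))" using that by simp
      then show ?thesis using genideal_insert_subset[OF L g sub, of x] by metis
    qed
  qed
  moreover have "ideal_length R K (Idl (K \<union> G)) \<le> enat (card G)"
    using insert.IH[OF G'] insert.prems(2) by auto
  ultimately have "ideal_length R K (Idl (K \<union> insert g G)) \<le> enat (card G) + 1"
    unfolding ideal_length_genideal_insert[OF K insert.prems(1)] by (intro add_mono)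
  then show ?case using insert.hyps by (simp add: one_enat_def)
qed

text \<open>The step of Nakayama's lemma: modulo the ideal of \<open>G\<close>, an element of \<open>\<mm> \<cdot> J\<close>, where \<open>J\<close> is
  generated by \<open>g\<close> and \<open>G\<close>, is a multiple \<open>rg\<close> with \<open>r \<in> \<mm>\<close>. So \<open>(1 - r)g\<close> is in the ideal of \<open>G\<close>,
  and \<open>1 - r\<close> is a unit.\<close>

lemma generator_redundant:
  assumes G: "insert g G \<subseteq> carrier R" "g \<in> Idl (\<mm> \<cdot> (Idl (insert g G)) \<union> G)"
  shows "g \<in> Idl G"
proof -
  interpret m: ideal \<mm> R by (rule \<mm>_ideal)
  have g: "g \<in> carrier R" and G': "G \<subseteq> carrier R" using G(1) by auto
  have H: "ideal (Idl G) R" using genideal_ideal[OF G'] .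
  have GH: "G \<subseteq> Idl G" using genideal_self[OF G'] .
  interpret H: ideal "Idl G" R by fact
  \<comment> \<open>\<open>E\<close> is the ideal \<open>Idl G + \<mm>g\<close>; it contains both \<open>G\<close> and \<open>\<mm> \<cdot> J\<close>.\<close>
  define E where "E = {h \<oplus> r \<otimes> g | h r. h \<in> Idl G \<and> r \<in> \<mm>}"
  have E_I: "h \<oplus> r \<otimes> g \<in> E" if "h \<in> Idl G" "r \<in> \<mm>" for h r
    unfolding E_def using that by blast
  have E: "ideal E R"
  proof (rule ideal_criterion)
    show "E \<subseteq> carrier R" using g by (auto simp: E_def)
    have "\<zero> \<oplus> \<zero> \<otimes> g \<in> E" by (intro E_I H.zero_closed m.zero_closed)
    then show "\<zero> \<in> E" using g by simp
    show "x \<oplus> y \<in> E" if xy: "x \<in> E" "y \<in> E" for x y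
    proof -
      obtain h r h' r' where *: "h \<in> Idl G" "r \<in> \<mm>" "x = h \<oplus> r \<otimes> g" "h' \<in> Idl G" "r' \<in> \<mm>" "y = h' \<oplus> r' \<otimes> g"
        using xy unfolding E_def by blast
      have "x \<oplus> y = (h \<oplus> h') \<oplus> (r \<oplus> r') \<otimes> g"
        using * g H.a_Hcarr[of h] H.a_Hcarr[of h'] m.a_Hcarr[of r] m.a_Hcarr[of r'] by algebra
      also have "\<dots> \<in> E" using * by (intro E_I H.a_closed m.a_closed)
      finally show ?thesis .
    qed
    show "s \<otimes> x \<in> E" if s: "s \<in> carrier R" and x: "x \<in> E" for s x
    proof -
      obtain h r where *: "h \<in> Idl G" "r \<in> \<mm>" "x = h \<oplus> r \<otimes> g" using x unfolding E_def by blast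
      have "s \<otimes> x = s \<otimes> h \<oplus> (s \<otimes> r) \<otimes> g"
        using * g s H.a_Hcarr[of h] m.a_Hcarr[of r] by algebra
      also have "\<dots> \<in> E" using * s by (intro E_I H.I_l_closed m.I_l_closed)
      finally show ?thesis .
    qed
  qed
  interpret E: ideal E R by fact
  have "h \<oplus> \<zero> \<otimes> g \<in> E" if "h \<in> Idl G" for h using that by (intro E_I m.zero_closed)
  then have GE: "G \<subseteq> E" using GH g G' by (auto simp: subset_iff)
  have "\<mm> \<cdot> (Idl (insert g G)) \<subseteq> E"
  proof
    fix s assume "s \<in> \<mm> \<cdot> (Idl (insert g G))"
    then show "s \<in> E"
    proof (induction rule: ideal_prod.induct)
      case (prod i j)
      obtain h r where hr: "h \<in> Idl G" "r \<in> carrier R" "j = h \<oplus> r \<otimes> g"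
        using genideal_insert_subset[OF H g GH prod(2)] .
      have "i \<otimes> j = i \<otimes> h \<oplus> (i \<otimes> r) \<otimes> g"
        using hr g m.a_Hcarr[OF prod(1)] H.a_Hcarr[OF hr(1)] by algebra
      also have "\<dots> \<in> E"
        using hr(1,2) prod(1) m.a_Hcarr[OF prod(1)] by (intro E_I H.I_l_closed m.I_r_closed)
      finally show ?case .
    qed simp
  qed
  then have "Idl (\<mm> \<cdot> (Idl (insert g G)) \<union> G) \<subseteq> E" using GE by (intro genideal_minimal[OF E]) simp
  then obtain h r where hr: "h \<in> Idl G" "r \<in> \<mm>" "g = h \<oplus> r \<otimes> g" using G(2) unfolding E_def by blast
  have c: "h \<in> carrier R" "r \<in> carrier R" using hr by auto
  have "(\<one> \<ominus> r) \<otimes> g = g \<ominus> r \<otimes> g" using c g by algebra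
  also have "\<dots> = (h \<oplus> r \<otimes> g) \<ominus> r \<otimes> g" using hr(3) by simp
  also have "\<dots> = h" using c g by algebra
  finally have eq: "(\<one> \<ominus> r) \<otimes> g = h" .
  have "\<one> \<ominus> r \<notin> \<mm>"
  proof
    assume "\<one> \<ominus> r \<in> \<mm>"
    then have "(\<one> \<ominus> r) \<oplus> r \<in> \<mm>" using hr(2) by simp
    moreover have "(\<one> \<ominus> r) \<oplus> r = \<one>" using c by algebra
    ultimately show False using one_notin_\<mm> by simp
  qed
  then have u: "\<one> \<ominus> r \<in> Units R" using c by (intro Units_if_notin_\<mm>) auto
  have "inv (\<one> \<ominus> r) \<otimes> h \<in> Idl G" using u hr(1) by (intro H.I_l_closed) auto
  moreover have "inv (\<one> \<ominus> r) \<otimes> h = g"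
    using u g c unfolding eq[symmetric] by (simp add: m_assoc[symmetric])
  ultimately show ?thesis by simp
qed

text \<open>Adjoin the elements of a smallest generating set \<open>G\<close> to \<open>\<mm>J\<close> one by one. Each step adds at most 1
  to the length, and at least 1 because no element of \<open>G\<close> is redundant.\<close>

lemma min_gens_eq_ideal_length:
  assumes "\<exists>S\<subseteq>carrier R. finite S \<and> Idl S = J"
  shows "enat (min_gens R J) = ideal_length R (\<mm> \<cdot> J) J"
proof -
  let ?P = "\<lambda>n. \<exists>S\<subseteq>carrier R. finite S \<and> card S = n \<and> Idl S = J"
  have "\<exists>n. ?P n" using assms by blast
  then have "?P (min_gens R J)" unfolding min_gens_def by (rule LeastI_ex)
  then obtain G where G: "G \<subseteq> carrier R" "finite G" "card G = min_gens R J" "Idl G = J" by blast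
  have least: "card G \<le> card S" if "S \<subseteq> carrier R" "finite S" "Idl S = J" for S
    unfolding G(3) min_gens_def by (rule Least_le) (use that in blast)
  have J: "ideal J R" using genideal_ideal[OF G(1)] G(4) by simp
  define K where "K = \<mm> \<cdot> J"
  have K: "ideal K R" unfolding K_def by (rule ideal_prod_is_ideal[OF \<mm>_ideal J])
  have KJ: "K \<subseteq> J" unfolding K_def using ideal_prod_inter[OF \<mm>_ideal J] by blast
  have GJ: "G \<subseteq> J" using genideal_self[OF G(1)] G(4) by simp
  have JKG: "Idl (K \<union> G) = J"
  proof
    show "Idl (K \<union> G) \<subseteq> J" using KJ GJ by (intro genideal_minimal[OF J]) simp
    have "Idl G \<subseteq> Idl (K \<union> G)"
      using Un_subset_genideal[OF K G(1)] by (intro genideal_minimal ideal_genideal_Un[OF K G(1)]) simp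
    then show "J \<subseteq> Idl (K \<union> G)" using G(4) by simp
  qed
  have "ideal_length R K (Idl (K \<union> G)) \<le> enat (card G)"
  proof (rule ideal_length_genideal_le_card[OF K G(2,1)])
    show "r \<otimes> g \<in> K" if "r \<in> \<mm>" "g \<in> G" for r g
      unfolding K_def using that GJ by (intro ideal_prod.prod) auto
  qed
  moreover have "enat (card G') \<le> ideal_length R K (Idl (K \<union> G'))" if "G' \<subseteq> G" for G'
    using finite_subset[OF that G(2)] that
  proof (induction G' rule: finite_induct)
    case (insert g G')
    have c: "insert g G' \<subseteq> carrier R" using insert.prems G(1) by auto
    have irr: "g \<notin> Idl (K \<union> G')"
    proof
      assume g: "g \<in> Idl (K \<union> G')"
      let ?H = "G - {g}"
      have ins: "insert g ?H = G" using insert.prems by auto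
      have Hc: "?H \<subseteq> carrier R" using G(1) by auto
      have "K \<union> ?H \<subseteq> Idl (K \<union> ?H)" using Un_subset_genideal[OF K Hc] .
      then have "Idl (K \<union> G') \<subseteq> Idl (K \<union> ?H)"
        using insert.prems insert.hyps by (intro genideal_minimal[OF ideal_genideal_Un[OF K Hc]]) blast
      then have "g \<in> Idl (\<mm> \<cdot> (Idl (insert g ?H)) \<union> ?H)"
        using g unfolding ins G(4) K_def by (rule subsetD)
      then have "g \<in> Idl ?H"
        by (rule generator_redundant[rotated]) (use G(1) insert.prems in auto)
      then have "G \<subseteq> Idl ?H" using genideal_self[OF Hc] by blast
      then have "Idl G \<subseteq> Idl ?H" by (rule genideal_minimal[OF genideal_ideal[OF Hc]])
      moreover have "Idl ?H \<subseteq> J" using GJ by (intro genideal_minimal[OF J]) auto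
      ultimately have "Idl ?H = J" using G(4) by auto
      then have "card G \<le> card ?H" using least[OF Hc] G(2) by simp
      moreover have "g \<in> G" using insert.prems by simp
      ultimately show False using G(2) by (metis card_Diff1_less leD)
    qed
    have c': "G' \<subseteq> carrier R" using c by auto
    have "Idl (K \<union> G') \<subset> Idl (K \<union> insert g G')"
    proof
      show "Idl (K \<union> G') \<subseteq> Idl (K \<union> insert g G')"
        using Un_subset_genideal[OF K c] by (intro genideal_minimal[OF ideal_genideal_Un[OF K c]]) auto
      show "Idl (K \<union> G') \<noteq> Idl (K \<union> insert g G')"
      proof
        assume eq: "Idl (K \<union> G') = Idl (K \<union> insert g G')"
        have "g \<in> Idl (K \<union> insert g G')" using Un_subset_genideal[OF K c] by blast
        then show False using irr unfolding eq by simp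
      qed
    qed
    then have "1 \<le> ideal_length R (Idl (K \<union> G')) (Idl (K \<union> insert g G'))"
      by (intro ideal_length_pos ideal_genideal_Un[OF K] c c')
    then have "enat (card G') + 1 \<le> ideal_length R K (Idl (K \<union> insert g G'))"
      unfolding ideal_length_genideal_insert[OF K c] using insert.IH insert.prems by (intro add_mono) auto
    then show ?case using insert.hyps by (simp add: one_enat_def)
  qed (simp add: zero_enat_def[symmetric])
  ultimately show ?thesis using G(3) JKG unfolding K_def by (metis antisym order_refl)
qed

end

section \<open>Rings of the form \<open>R + It\<close> with a quadratic relation\<close>

lemma ideal_power_0: "ideal_power A J 0 = carrier A"
  by (simp add: ideals_set_def)

lemma ideal_power_Suc: "ideal_power A J (Suc n) = ideal_power A J n \<cdot>\<^bsub>A\<^esub> J"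
  by (simp add: nat_pow_def ideals_set_def)

lemma (in ring) ideal_power_ideal: "ideal J R \<Longrightarrow> ideal (ideal_power R J n) R"
  by (induction n) (auto simp only: ideal_power_0 ideal_power_Suc oneideal ideal_prod_is_ideal)

lemma (in cring) ideal_power_1: "ideal J R \<Longrightarrow> ideal_power R J 1 = J"
  using ideal_prod_one[of J] ideal_prod_commute[OF _ oneideal, of J]
  by (simp only: One_nat_def ideal_power_Suc ideal_power_0)

lemma (in ring) ideal_prod_subset:
  assumes "ideal H R" "\<And>i j. i \<in> J \<Longrightarrow> j \<in> K \<Longrightarrow> i \<otimes> j \<in> H"
  shows "J \<cdot> K \<subseteq> H"
proof
  fix x assume "x \<in> J \<cdot> K"
  then show "x \<in> H"
    by (induction rule: ideal_prod.induct)
      (auto intro: assms(2) additive_subgroup.a_closed[OF ideal.axioms(1)[OF assms(1)]])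
qed

text \<open>All facts about \<open>R(I)\<^sub>a\<^sub>,\<^sub>b\<close> are derived from this description: \<open>\<phi> r i\<close> stands for \<open>r + it\<close>, each
  element of \<open>S\<close> has this form for exactly one \<open>r \<in> R\<close> and \<open>i \<in> I\<close>, and \<open>t\<^sup>2 = -at - b\<close>.\<close>

locale quadratic_extension = R: local_cring R \<mm> + I: ideal I R + S: cring S
  for R (structure) and \<mm> and I and S (structure) +
  fixes \<phi> :: "'a \<Rightarrow> 'a \<Rightarrow> 'c" and a b :: 'a
  assumes a [simp]: "a \<in> carrier R" and b [simp]: "b \<in> carrier R" and I_subset_\<mm>: "I \<subseteq> \<mm>"
    and bij: "bij_betw (\<lambda>(r, i). \<phi> r i) (carrier R \<times> I) (carrier S)"
    and \<phi>_one: "\<phi> \<one> \<zero> = \<one>\<^bsub>S\<^esub>"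
    and \<phi>_add: "\<lbrakk>r \<in> carrier R; s \<in> carrier R; i \<in> I; j \<in> I\<rbrakk> \<Longrightarrow> \<phi> r i \<oplus>\<^bsub>S\<^esub> \<phi> s j = \<phi> (r \<oplus> s) (i \<oplus> j)"
    and \<phi>_mult: "\<lbrakk>r \<in> carrier R; s \<in> carrier R; i \<in> I; j \<in> I\<rbrakk> \<Longrightarrow>
      \<phi> r i \<otimes>\<^bsub>S\<^esub> \<phi> s j = \<phi> (r \<otimes> s \<ominus> b \<otimes> (i \<otimes> j)) (r \<otimes> j \<oplus> s \<otimes> i \<ominus> a \<otimes> (i \<otimes> j))"
begin

sublocale \<mm>: ideal \<mm> R by (rule R.\<mm>_ideal)

lemma \<phi>_closed [simp]: "\<lbrakk>r \<in> carrier R; i \<in> I\<rbrakk> \<Longrightarrow> \<phi> r i \<in> carrier S"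
  using bij_betwE[OF bij] by auto

lemma \<phi>_eq_iff [simp]:
  "\<lbrakk>r \<in> carrier R; s \<in> carrier R; i \<in> I; j \<in> I\<rbrakk> \<Longrightarrow> \<phi> r i = \<phi> s j \<longleftrightarrow> r = s \<and> i = j"
  using bij_betw_imp_inj_on[OF bij] by (auto simp: inj_on_def)

lemma \<phi>_cases:
  assumes "x \<in> carrier S"
  obtains r i where "r \<in> carrier R" "i \<in> I" "x = \<phi> r i"
proof -
  have "x \<in> (\<lambda>(r, i). \<phi> r i) ` (carrier R \<times> I)"
    using assms bij_betw_imp_surj_on[OF bij] by simp
  then show thesis using that by auto
qed

lemma I_carrier [simp]: "i \<in> I \<Longrightarrow> i \<in> carrier R"
  by (rule I.a_Hcarr)

lemma I_zero [simp]: "\<zero> \<in> I"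
  by (rule I.zero_closed)

lemma \<phi>_mult_R:
  assumes "r \<in> carrier R" "s \<in> carrier R" "i \<in> I"
  shows "\<phi> r \<zero> \<otimes>\<^bsub>S\<^esub> \<phi> s i = \<phi> (r \<otimes> s) (r \<otimes> i)"
  using assms \<phi>_mult[of r s \<zero> i] by (simp add: R.minus_eq)

lemma \<phi>_split:
  assumes "r \<in> carrier R" "i \<in> I"
  shows "\<phi> r i = \<phi> r \<zero> \<oplus>\<^bsub>S\<^esub> \<phi> \<zero> i"
  using assms by (simp add: \<phi>_add)

lemma \<phi>_zero [simp]: "\<phi> \<zero> \<zero> = \<zero>\<^bsub>S\<^esub>"
proof -
  have "\<phi> \<zero> \<zero> \<oplus>\<^bsub>S\<^esub> \<phi> \<zero> \<zero> = \<phi> \<zero> \<zero>" by (simp add: \<phi>_add)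
  then show ?thesis by (simp add: S.add.r_cancel_one)
qed

text \<open>The set \<open>J + Kt\<close>.\<close>

definition pair_set :: "'a set \<Rightarrow> 'a set \<Rightarrow> 'c set"
  where "pair_set J K = (\<lambda>(r, i). \<phi> r i) ` (J \<times> K)"

lemma pair_setI: "r \<in> J \<Longrightarrow> i \<in> K \<Longrightarrow> \<phi> r i \<in> pair_set J K"
  by (auto simp: pair_set_def)

lemma pair_setE:
  assumes "x \<in> pair_set J K"
  obtains r i where "r \<in> J" "i \<in> K" "x = \<phi> r i"
  using assms by (auto simp: pair_set_def)

lemma pair_set_mem_iff:
  "\<lbrakk>r \<in> carrier R; i \<in> I; J \<subseteq> carrier R; K \<subseteq> I\<rbrakk> \<Longrightarrow> \<phi> r i \<in> pair_set J K \<longleftrightarrow> r \<in> J \<and> i \<in> K"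
  by (force simp: pair_set_def subset_iff)

lemma pair_set_carrier: "pair_set (carrier R) I = carrier S"
  unfolding pair_set_def by (rule bij_betw_imp_surj_on[OF bij])

lemma pair_set_mono: "J \<subseteq> J' \<Longrightarrow> K \<subseteq> K' \<Longrightarrow> pair_set J K \<subseteq> pair_set J' K'"
  by (auto simp: pair_set_def)

text \<open>Multiplying \<open>r + kt\<close> by \<open>s + it\<close> produces \<open>rs - bik\<close> and \<open>ri + sk - aik\<close>. The terms with \<open>a\<close> and
  \<open>b\<close> involve \<open>IK\<close>, and the term \<open>ri\<close> involves \<open>IJ\<close>.\<close>

lemma ideal_pair_set:
  assumes J: "ideal J R" and K: "ideal K R" and KI: "K \<subseteq> I"
    and IK: "\<And>i k. i \<in> I \<Longrightarrow> k \<in> K \<Longrightarrow> i \<otimes> k \<in> J" and IJ: "\<And>i r. i \<in> I \<Longrightarrow> r \<in> J \<Longrightarrow> i \<otimes> r \<in> K"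
  shows "ideal (pair_set J K) S"
proof (rule S.ideal_criterion)
  interpret J: ideal J R by fact
  interpret K: ideal K R by fact
  show "pair_set J K \<subseteq> carrier S" using KI by (auto simp: pair_set_def)
  show "\<zero>\<^bsub>S\<^esub> \<in> pair_set J K" using pair_setI[OF J.zero_closed K.zero_closed] by simp
  show "x \<oplus>\<^bsub>S\<^esub> y \<in> pair_set J K" if xy: "x \<in> pair_set J K" "y \<in> pair_set J K" for x y
  proof -
    obtain r i s j where *: "r \<in> J" "i \<in> K" "x = \<phi> r i" "s \<in> J" "j \<in> K" "y = \<phi> s j"
      using xy by (elim pair_setE)
    then have "x \<oplus>\<^bsub>S\<^esub> y = \<phi> (r \<oplus> s) (i \<oplus> j)" using KI by (simp add: \<phi>_add subset_iff)
    then show ?thesis using * by (simp add: pair_setI)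
  qed
  show "y \<otimes>\<^bsub>S\<^esub> x \<in> pair_set J K" if y: "y \<in> carrier S" and x: "x \<in> pair_set J K" for x y
  proof -
    obtain s j where y': "s \<in> carrier R" "j \<in> I" "y = \<phi> s j" using y by (rule \<phi>_cases)
    obtain r i where x': "r \<in> J" "i \<in> K" "x = \<phi> r i" using x by (rule pair_setE)
    have i: "i \<in> I" "r \<in> carrier R" using x' KI by auto
    have ji: "j \<otimes> i \<in> J" "j \<otimes> i \<in> K" using IK[OF y'(2) x'(2)] K.I_l_closed[OF x'(2)] y' by auto
    have "r \<otimes> j \<in> K" using IJ[OF y'(2) x'(1)] y' i by (simp add: R.m_comm)
    then have "s \<otimes> i \<oplus> r \<otimes> j \<ominus> a \<otimes> (j \<otimes> i) \<in> K"
      using K.I_l_closed[OF x'(2) y'(1)] K.I_l_closed[OF ji(2) a]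
      by (intro R.ideal_minus_closed[OF K] K.a_closed)
    moreover have "s \<otimes> r \<ominus> b \<otimes> (j \<otimes> i) \<in> J"
      using J.I_l_closed[OF x'(1) y'(1)] J.I_l_closed[OF ji(1) b] by (rule R.ideal_minus_closed[OF J])
    ultimately show ?thesis
      unfolding y'(3) x'(3) \<phi>_mult[OF y'(1) i(2) y'(2) i(1)] by (rule pair_setI[rotated])
  qed
qed

abbreviation \<nn> :: "'c set" where "\<nn> \<equiv> pair_set \<mm> I"

lemma \<nn>_ideal: "ideal \<nn> S"
proof (rule ideal_pair_set[OF R.\<mm>_ideal I.is_ideal order_refl])
  show "i \<otimes> k \<in> \<mm>" if "i \<in> I" "k \<in> I" for i k
    using that I_subset_\<mm> by (intro \<mm>.I_l_closed) auto
  show "i \<otimes> r \<in> I" if "i \<in> I" "r \<in> \<mm>" for i r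
    using that(1) \<mm>.a_Hcarr[OF that(2)] by (rule I.I_r_closed)
qed

text \<open>The conjugate of \<open>r + it\<close> comes from exchanging \<open>t\<close> with the second root \<open>-a - t\<close> of
  \<open>t\<^sup>2 + at + b\<close>. Sum and product of the two conjugates are the trace and the norm, which lie in \<open>R\<close>.\<close>

lemma conjugate:
  assumes r: "r \<in> carrier R" and i: "i \<in> I"
  shows "\<phi> r i \<oplus>\<^bsub>S\<^esub> \<phi> (r \<ominus> a \<otimes> i) (\<ominus> i) = \<phi> (r \<oplus> r \<ominus> a \<otimes> i) \<zero>"
    and "\<phi> r i \<otimes>\<^bsub>S\<^esub> \<phi> (r \<ominus> a \<otimes> i) (\<ominus> i) = \<phi> (r \<otimes> r \<ominus> (a \<otimes> r \<ominus> b \<otimes> i) \<otimes> i) \<zero>"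
proof -
  have ic: "i \<in> carrier R" using i by simp
  have "r \<oplus> (r \<ominus> a \<otimes> i) = r \<oplus> r \<ominus> a \<otimes> i" "i \<oplus> (\<ominus> i) = \<zero>" using r ic a by algebra+
  then show "\<phi> r i \<oplus>\<^bsub>S\<^esub> \<phi> (r \<ominus> a \<otimes> i) (\<ominus> i) = \<phi> (r \<oplus> r \<ominus> a \<otimes> i) \<zero>"
    using r i by (simp add: \<phi>_add)
  have "\<phi> r i \<otimes>\<^bsub>S\<^esub> \<phi> (r \<ominus> a \<otimes> i) (\<ominus> i) = \<phi> (r \<otimes> (r \<ominus> a \<otimes> i) \<ominus> b \<otimes> (i \<otimes> (\<ominus> i)))
      (r \<otimes> (\<ominus> i) \<oplus> (r \<ominus> a \<otimes> i) \<otimes> i \<ominus> a \<otimes> (i \<otimes> (\<ominus> i)))"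
    using r i by (intro \<phi>_mult) auto
  also have "r \<otimes> (r \<ominus> a \<otimes> i) \<ominus> b \<otimes> (i \<otimes> (\<ominus> i)) = r \<otimes> r \<ominus> (a \<otimes> r \<ominus> b \<otimes> i) \<otimes> i"
    using r ic a b by algebra
  also have "r \<otimes> (\<ominus> i) \<oplus> (r \<ominus> a \<otimes> i) \<otimes> i \<ominus> a \<otimes> (i \<otimes> (\<ominus> i)) = \<zero>"
    using r ic a b by algebra
  finally show "\<phi> r i \<otimes>\<^bsub>S\<^esub> \<phi> (r \<ominus> a \<otimes> i) (\<ominus> i) = \<phi> (r \<otimes> r \<ominus> (a \<otimes> r \<ominus> b \<otimes> i) \<otimes> i) \<zero>" .
qed

text \<open>If \<open>r \<notin> \<mm>\<close>, then the norm of \<open>r + it\<close> is congruent to \<open>r\<^sup>2\<close> modulo \<open>\<mm>\<close>, hence a unit of \<open>R\<close>. So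
  \<open>r + it\<close> is a unit.\<close>

sublocale S: local_cring S \<nn>
proof (intro local_cring.intro local_cring_axioms.intro S.is_cring)
  show "ideal \<nn> S" by (rule \<nn>_ideal)
  show "\<one>\<^bsub>S\<^esub> \<notin> \<nn>"
    using pair_set_mem_iff[of \<one> \<zero> \<mm> I] \<mm>.a_subset R.one_notin_\<mm> by (simp add: \<phi>_one)
  fix x assume x: "x \<in> carrier S" "x \<notin> \<nn>"
  obtain r i where ri: "r \<in> carrier R" "i \<in> I" "x = \<phi> r i" using x(1) by (rule \<phi>_cases)
  let ?y = "\<phi> (r \<ominus> a \<otimes> i) (\<ominus> i)" and ?N = "r \<otimes> r \<ominus> (a \<otimes> r \<ominus> b \<otimes> i) \<otimes> i"
  have "r \<notin> \<mm>" using x(2) ri by (auto intro: pair_setI)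
  then have "r \<in> Units R" using ri(1) R.Units_if_notin_\<mm> by blast
  then have rr: "r \<otimes> r \<in> Units R" by (rule R.Units_m_closed) fact
  have "?N \<notin> \<mm>"
  proof
    assume N: "?N \<in> \<mm>"
    have "(a \<otimes> r \<ominus> b \<otimes> i) \<otimes> i \<in> \<mm>"
      using ri I_subset_\<mm> by (intro \<mm>.I_l_closed) auto
    with N have "?N \<oplus> (a \<otimes> r \<ominus> b \<otimes> i) \<otimes> i \<in> \<mm>" by (rule \<mm>.a_closed)
    moreover have "?N \<oplus> (a \<otimes> r \<ominus> b \<otimes> i) \<otimes> i = r \<otimes> r"
      using ri(1) I_carrier[OF ri(2)] a b by algebra
    ultimately have "r \<otimes> r \<in> \<mm>" by simp
    then have "\<mm> = carrier R" using R.ideal_eq_carrier_if_unit[OF R.\<mm>_ideal _ rr] by blast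
    then show False using R.one_notin_\<mm> by simp
  qed
  then have N: "?N \<in> Units R" using ri by (intro R.Units_if_notin_\<mm>) auto
  let ?z = "?y \<otimes>\<^bsub>S\<^esub> \<phi> (inv ?N) \<zero>"
  have c: "?y \<in> carrier S" "\<phi> (inv ?N) \<zero> \<in> carrier S" using ri N by auto
  have "x \<otimes>\<^bsub>S\<^esub> ?z = \<phi> ?N \<zero> \<otimes>\<^bsub>S\<^esub> \<phi> (inv ?N) \<zero>"
    using c x(1) conjugate(2)[OF ri(1,2)] by (simp add: S.m_assoc[symmetric] ri(3))
  also have "\<dots> = \<one>\<^bsub>S\<^esub>"
    unfolding \<phi>_mult_R[OF R.Units_closed[OF N] R.Units_inv_closed[OF N] I_zero]
      R.Units_r_inv[OF N] R.r_null[OF R.Units_closed[OF N]] by (rule \<phi>_one)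
  finally have "x \<otimes>\<^bsub>S\<^esub> ?z = \<one>\<^bsub>S\<^esub>" .
  moreover from this have "?z \<otimes>\<^bsub>S\<^esub> x = \<one>\<^bsub>S\<^esub>" using c x(1) by (simp add: S.m_comm)
  moreover have "?z \<in> carrier S" using c by simp
  ultimately show "x \<in> Units S" using x(1) unfolding Units_def by blast
qed

abbreviation \<mm>_power :: "nat \<Rightarrow> 'a set" where "\<mm>_power k \<equiv> ideal_power R \<mm> k"

text \<open>The ideal of the coefficients of \<open>t\<close> in the elements of \<open>\<nn>\<^sup>k\<close>. The case \<open>k = 0\<close> cannot follow the
  formula \<open>\<mm>\<^sup>k\<^sup>-\<^sup>1 I\<close>, because \<open>\<nn>\<^sup>0 = S\<close>.\<close>

definition linear_part :: "nat \<Rightarrow> 'a set"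
  where "linear_part k = (case k of 0 \<Rightarrow> I | Suc l \<Rightarrow> \<mm>_power l \<cdot> I)"

lemma linear_part_simps: "linear_part 0 = I" "linear_part (Suc k) = \<mm>_power k \<cdot> I"
  by (simp_all add: linear_part_def)

lemma \<mm>_power_ideal: "ideal (\<mm>_power k) R"
  by (rule R.ideal_power_ideal[OF R.\<mm>_ideal])

lemma linear_part_ideal: "ideal (linear_part k) R"
  by (cases k) (auto simp only: linear_part_simps intro: I.is_ideal R.ideal_prod_is_ideal \<mm>_power_ideal)

lemma linear_part_subset_I: "linear_part k \<subseteq> I"
  using R.ideal_prod_inter[OF \<mm>_power_ideal I.is_ideal]
  by (cases k) (auto simp only: linear_part_simps)

lemma linear_part_subset_\<mm>_power: "linear_part k \<subseteq> \<mm>_power k"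
proof (cases k)
  case (Suc l)
  have "\<mm>_power l \<cdot> I \<subseteq> \<mm>_power l \<cdot> \<mm>"
    using I_subset_\<mm> by (intro R.ideal_prod_subset R.ideal_prod_is_ideal \<mm>_power_ideal R.\<mm>_ideal ideal_prod.prod) auto
  then show ?thesis by (simp only: Suc linear_part_simps ideal_power_Suc)
qed (simp only: linear_part_simps ideal_power_0, rule I.a_subset)

lemma \<mm>_linear_part:
  assumes s: "s \<in> \<mm>" and i: "i \<in> linear_part k"
  shows "s \<otimes> i \<in> linear_part (Suc k)"
proof (cases k)
  case 0
  then show ?thesis using s i
    by (auto simp only: linear_part_simps ideal_power_0 intro: ideal_prod.prod \<mm>.a_Hcarr)
next
  case (Suc l)
  interpret L: ideal "linear_part (Suc k)" R by (rule linear_part_ideal)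
  have "i \<in> \<mm>_power l \<cdot> I" using i by (simp only: Suc linear_part_simps)
  then show ?thesis
  proof (induction rule: ideal_prod.induct)
    case (prod u v)
    have u: "u \<in> carrier R" using prod(1) ideal.Icarr[OF \<mm>_power_ideal] by blast
    have "s \<otimes> (u \<otimes> v) = (u \<otimes> s) \<otimes> v"
      using s u I_carrier[OF prod(2)] \<mm>.a_Hcarr[OF s] by algebra
    moreover have "u \<otimes> s \<in> \<mm>_power k"
      unfolding Suc ideal_power_Suc using prod(1) s by (rule ideal_prod.prod)
    ultimately show ?case using prod(2) by (simp only: linear_part_simps ideal_prod.prod)
  next
    case (sum x y)
    have "x \<in> I" "y \<in> I"
      using sum.hyps R.ideal_prod_inter[OF \<mm>_power_ideal I.is_ideal] by blast+
    then have "s \<otimes> (x \<oplus> y) = s \<otimes> x \<oplus> s \<otimes> y" using \<mm>.a_Hcarr[OF s] by (simp add: R.r_distr)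
    then show ?case using sum.IH by simp
  qed
qed

definition \<nn>_layer :: "nat \<Rightarrow> 'c set"
  where "\<nn>_layer k = pair_set (\<mm>_power k) (linear_part k)"

text \<open>The terms \<open>b(ij)\<close> and \<open>a(ij)\<close> stay in the next layer because \<open>i \<in> \<mm>\<^sup>k\<close> and
  \<open>j \<in> I \<subseteq> \<mm>\<close>.\<close>

lemma \<nn>_layer_mult:
  assumes r: "r \<in> \<mm>_power k" "i \<in> linear_part k" and s: "s \<in> \<mm>" "j \<in> I"
  shows "\<phi> r i \<otimes>\<^bsub>S\<^esub> \<phi> s j \<in> \<nn>_layer (Suc k)"
proof -
  have c: "r \<in> carrier R" "s \<in> carrier R" "i \<in> I" "j \<in> I"
    using r s linear_part_subset_I ideal.Icarr[OF \<mm>_power_ideal] by auto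
  have ij: "i \<otimes> j \<in> \<mm>_power (Suc k)" "i \<otimes> j \<in> linear_part (Suc k)"
    using r(2) s(2) I_subset_\<mm> linear_part_subset_\<mm>_power[of k]
    unfolding ideal_power_Suc linear_part_simps by (auto intro: ideal_prod.prod)
  have "r \<otimes> s \<in> \<mm>_power (Suc k)" unfolding ideal_power_Suc using r s by (intro ideal_prod.prod)
  then have 1: "r \<otimes> s \<ominus> b \<otimes> (i \<otimes> j) \<in> \<mm>_power (Suc k)"
    using ideal.I_l_closed[OF \<mm>_power_ideal ij(1) b] by (rule R.ideal_minus_closed[OF \<mm>_power_ideal])
  interpret L: ideal "linear_part (Suc k)" R by (rule linear_part_ideal)
  have "r \<otimes> j \<in> linear_part (Suc k)" unfolding linear_part_simps using r s by (intro ideal_prod.prod)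
  moreover have "s \<otimes> i \<in> linear_part (Suc k)" using s(1) r(2) by (rule \<mm>_linear_part)
  ultimately have 2: "r \<otimes> j \<oplus> s \<otimes> i \<ominus> a \<otimes> (i \<otimes> j) \<in> linear_part (Suc k)"
    using L.I_l_closed[OF ij(2) a] by (intro R.ideal_minus_closed[OF L.is_ideal] L.a_closed)
  show ?thesis unfolding \<phi>_mult[OF c] \<nn>_layer_def using 1 2 by (rule pair_setI)
qed

lemma \<nn>_layer_ideal: "ideal (\<nn>_layer k) S"
  unfolding \<nn>_layer_def
proof (rule ideal_pair_set[OF \<mm>_power_ideal linear_part_ideal linear_part_subset_I])
  show "i \<otimes> j \<in> \<mm>_power k" if "i \<in> I" "j \<in> linear_part k" for i j
    using that linear_part_subset_\<mm>_power by (intro ideal.I_l_closed[OF \<mm>_power_ideal]) auto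
  show "i \<otimes> r \<in> linear_part k" if "i \<in> I" "r \<in> \<mm>_power k" for i r
  proof (cases k)
    case 0
    then show ?thesis using that by (auto simp only: linear_part_simps ideal_power_0 intro: I.I_r_closed)
  next
    case (Suc l)
    have "r \<in> \<mm>_power l"
      using that(2) R.ideal_prod_inter[OF \<mm>_power_ideal R.\<mm>_ideal] unfolding Suc ideal_power_Suc by blast
    then have "r \<otimes> i \<in> linear_part k" unfolding Suc linear_part_simps using that(1) by (rule ideal_prod.prod)
    moreover have "r \<otimes> i = i \<otimes> r"
      using that ideal.Icarr[OF \<mm>_power_ideal] by (intro R.m_comm) auto
    ultimately show ?thesis by simp
  qed
qed

text \<open>The key point of the whole proof: \<open>\<nn>\<^sup>k = \<mm>\<^sup>k + \<mm>\<^sup>k\<^sup>-\<^sup>1It\<close> does not depend on \<open>a\<close> and \<open>b\<close>.\<close>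

lemma \<nn>_power: "ideal_power S \<nn> k = \<nn>_layer k"
proof (induction k)
  case 0
  show ?case by (simp only: \<nn>_layer_def ideal_power_0 linear_part_simps pair_set_carrier)
next
  case (Suc k)
  interpret m_k: ideal "\<mm>_power k" R by (rule \<mm>_power_ideal)
  interpret l_k: ideal "linear_part k" R by (rule linear_part_ideal)
  have "\<nn>_layer k \<cdot>\<^bsub>S\<^esub> \<nn> = \<nn>_layer (Suc k)"
  proof
    show "\<nn>_layer k \<cdot>\<^bsub>S\<^esub> \<nn> \<subseteq> \<nn>_layer (Suc k)"
      by (rule S.ideal_prod_subset[OF \<nn>_layer_ideal])
        (auto simp only: \<nn>_layer_def[of k] elim!: pair_setE intro: \<nn>_layer_mult)
    have const: "\<phi> r \<zero> \<in> \<nn>_layer k \<cdot>\<^bsub>S\<^esub> \<nn>" if "r \<in> \<mm>_power k \<cdot> \<mm>" for r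
      using that
    proof (induction rule: ideal_prod.induct)
      case (prod u v)
      then have "\<phi> (u \<otimes> v) \<zero> = \<phi> u \<zero> \<otimes>\<^bsub>S\<^esub> \<phi> v \<zero>" by (simp add: \<phi>_mult_R)
      then show ?case using prod by (simp only: \<nn>_layer_def) (intro ideal_prod.prod pair_setI, auto)
    next
      case (sum u v)
      have "u \<in> carrier R" "v \<in> carrier R"
        using sum.hyps R.ideal_prod_in_carrier[OF \<mm>_power_ideal R.\<mm>_ideal] by blast+
      then have "\<phi> (u \<oplus> v) \<zero> = \<phi> u \<zero> \<oplus>\<^bsub>S\<^esub> \<phi> v \<zero>" by (simp add: \<phi>_add)
      then show ?case using sum.IH by (simp only: ideal_prod.sum)
    qed
    have lin: "\<phi> \<zero> i \<in> \<nn>_layer k \<cdot>\<^bsub>S\<^esub> \<nn>" if "i \<in> \<mm>_power k \<cdot> I" for i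
      using that
    proof (induction rule: ideal_prod.induct)
      case (prod u v)
      then have "\<phi> \<zero> (u \<otimes> v) = \<phi> u \<zero> \<otimes>\<^bsub>S\<^esub> \<phi> \<zero> v" by (simp add: \<phi>_mult_R)
      then show ?case using prod by (simp only: \<nn>_layer_def) (intro ideal_prod.prod pair_setI, auto)
    next
      case (sum u v)
      have "u \<in> I" "v \<in> I"
        using sum.hyps R.ideal_prod_inter[OF \<mm>_power_ideal I.is_ideal] by blast+
      then have "\<phi> \<zero> (u \<oplus> v) = \<phi> \<zero> u \<oplus>\<^bsub>S\<^esub> \<phi> \<zero> v" by (simp add: \<phi>_add)
      then show ?case using sum.IH by (simp only: ideal_prod.sum)
    qed
    show "\<nn>_layer (Suc k) \<subseteq> \<nn>_layer k \<cdot>\<^bsub>S\<^esub> \<nn>"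
    proof
      fix x assume "x \<in> \<nn>_layer (Suc k)"
      then obtain r i where *: "r \<in> \<mm>_power k \<cdot> \<mm>" "i \<in> \<mm>_power k \<cdot> I" "x = \<phi> r i"
        unfolding \<nn>_layer_def ideal_power_Suc linear_part_simps by (rule pair_setE)
      have "r \<in> carrier R" "i \<in> I"
        using * R.ideal_prod_in_carrier[OF \<mm>_power_ideal R.\<mm>_ideal]
          R.ideal_prod_inter[OF \<mm>_power_ideal I.is_ideal] by blast+
      then have "x = \<phi> r \<zero> \<oplus>\<^bsub>S\<^esub> \<phi> \<zero> i" unfolding *(3) by (rule \<phi>_split)
      then show "x \<in> \<nn>_layer k \<cdot>\<^bsub>S\<^esub> \<nn>"
        using const[OF *(1)] lin[OF *(2)] by (simp only: ideal_prod.sum)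
    qed
  qed
  then show ?case by (simp only: ideal_power_Suc Suc)
qed

end

section \<open>The Hilbert function and the multiplicity\<close>

context local_cring
begin

lemma ideal_power_antimono: "ideal_power R \<mm> (Suc k) \<subseteq> ideal_power R \<mm> k"
  unfolding ideal_power_Suc using ideal_prod_inter[OF ideal_power_ideal[OF \<mm>_ideal] \<mm>_ideal] by blast

lemma hilbert_fun_eq_ideal_length:
  "hilbert_fun R k = ideal_length R (ideal_power R \<mm> (Suc k)) (ideal_power R \<mm> k)"
  unfolding hilbert_fun_def max_ideal_eq
  by (rule module_length_ideal_quot[OF ideal_power_ideal[OF \<mm>_ideal] ideal_power_ideal[OF \<mm>_ideal]
      ideal_power_antimono])

lemma ideal_length_power_eq_sum_hilbert_fun:
  "ideal_length R (ideal_power R \<mm> k) (carrier R) = (\<Sum>j<k. hilbert_fun R j)"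
proof (induction k)
  case 0
  show ?case by (simp only: ideal_power_0 ideal_length_self lessThan_0 sum.empty)
next
  case (Suc k)
  have sub: "ideal_power R \<mm> k \<subseteq> carrier R"
    by (rule additive_subgroup.a_subset[OF ideal.axioms(1)[OF ideal_power_ideal[OF \<mm>_ideal]]])
  have "ideal_length R (ideal_power R \<mm> (Suc k)) (carrier R) =
      hilbert_fun R k + ideal_length R (ideal_power R \<mm> k) (carrier R)"
    unfolding hilbert_fun_eq_ideal_length
    by (rule ideal_length_add[OF ideal_power_ideal[OF \<mm>_ideal] ideal_power_ideal[OF \<mm>_ideal]
          oneideal ideal_power_antimono sub])
  then show ?case by (simp only: Suc sum.lessThan_Suc add.commute)
qed

text \<open>Since length is additive, the lengths that define the multiplicity are sums of values of the Hilbert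
  function.\<close>

lemma module_length_quot_power:
  "module_length R (ideal_quot R (carrier R) (ideal_power R (max_ideal R) k)) = (\<Sum>j<k. hilbert_fun R j)"
  unfolding max_ideal_eq ideal_length_power_eq_sum_hilbert_fun[symmetric]
  by (rule module_length_ideal_quot[OF ideal_power_ideal[OF \<mm>_ideal] oneideal
        additive_subgroup.a_subset[OF ideal.axioms(1)[OF ideal_power_ideal[OF \<mm>_ideal]]]])

lemma multiplicity_eq:
  "multiplicity R = (let d = the_enat (krull_dim R) in
     lim (\<lambda>k. fact d * real (the_enat (\<Sum>j<k. hilbert_fun R j)) / real k ^ d))"
  unfolding multiplicity_def module_length_quot_power ..

end

context quadratic_extension
begin

text \<open>The \<open>R\<close>-submodules of \<open>R \<times> I\<close> between the layers \<open>k + 1\<close> and \<open>k\<close>. The definition mentions neither \<open>S\<close>,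
  \<open>\<phi>\<close>, \<open>a\<close> nor \<open>b\<close>, so two quadratic extensions over the same \<open>R\<close> and \<open>I\<close> share it.\<close>

definition layer_submodules :: "nat \<Rightarrow> ('a \<times> 'a) set set"
  where "layer_submodules k = {X. \<mm>_power (Suc k) \<times> linear_part (Suc k) \<subseteq> X \<and>
    X \<subseteq> \<mm>_power k \<times> linear_part k \<and>
    (\<forall>(r, i)\<in>X. \<forall>(s, j)\<in>X. (r \<oplus> s, i \<oplus> j) \<in> X) \<and>
    (\<forall>u\<in>carrier R. \<forall>(r, i)\<in>X. (u \<otimes> r, u \<otimes> i) \<in> X)}"

lemma layer_subset: "\<mm>_power k \<times> linear_part k \<subseteq> carrier R \<times> I"
  using linear_part_subset_I ideal.Icarr[OF \<mm>_power_ideal] by auto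

text \<open>On \<open>\<nn>\<^sup>k/\<nn>\<^sup>k\<^sup>+\<^sup>1\<close> the elements of \<open>It\<close> act as zero. Hence a subgroup between the two layers is an ideal
  of \<open>S\<close> as soon as it is closed under multiplication by \<open>R\<close>.\<close>

lemma ideals_between_layers:
  "{N. ideal N S \<and> \<nn>_layer (Suc k) \<subseteq> N \<and> N \<subseteq> \<nn>_layer k} =
    (`) (\<lambda>(r, i). \<phi> r i) ` layer_submodules k"
proof (rule antisym; rule subsetI)
  fix N assume "N \<in> {N. ideal N S \<and> \<nn>_layer (Suc k) \<subseteq> N \<and> N \<subseteq> \<nn>_layer k}"
  then have N: "ideal N S" "\<nn>_layer (Suc k) \<subseteq> N" "N \<subseteq> \<nn>_layer k" by auto
  interpret N: ideal N S by fact
  define X where "X = {(r, i). (r, i) \<in> \<mm>_power k \<times> linear_part k \<and> \<phi> r i \<in> N}"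
  have NX: "N = (\<lambda>(r, i). \<phi> r i) ` X"
    using N(3) by (fastforce simp: X_def \<nn>_layer_def pair_set_def)
  have c: "r \<in> carrier R" "i \<in> I" if "(r, i) \<in> X" for r i
    using that layer_subset[of k] by (auto simp: X_def)
  interpret m: ideal "\<mm>_power k" R by (rule \<mm>_power_ideal)
  interpret l: ideal "linear_part k" R by (rule linear_part_ideal)
  have "\<mm>_power (Suc k) \<times> linear_part (Suc k) \<subseteq> X"
  proof clarify
    fix r i assume ri: "r \<in> \<mm>_power (Suc k)" "i \<in> linear_part (Suc k)"
    then have rc: "r \<in> carrier R" "i \<in> I" using layer_subset[of "Suc k"] by auto
    have "\<phi> r i \<in> N" using N(2) ri by (auto simp: \<nn>_layer_def pair_setI)
    moreover from this have "\<phi> r i \<in> \<nn>_layer k" using N(3) by blast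
    then have "r \<in> \<mm>_power k \<and> i \<in> linear_part k"
      using pair_set_mem_iff[OF rc m.a_subset linear_part_subset_I] by (simp add: \<nn>_layer_def)
    ultimately show "(r, i) \<in> X" by (simp add: X_def)
  qed
  moreover have "(r \<oplus> s, i \<oplus> j) \<in> X" if "(r, i) \<in> X" "(s, j) \<in> X" for r i s j
    using that c[OF that(1)] c[OF that(2)] N.a_closed[of "\<phi> r i" "\<phi> s j"]
    by (simp add: X_def \<phi>_add)
  moreover have "(u \<otimes> r, u \<otimes> i) \<in> X" if "u \<in> carrier R" "(r, i) \<in> X" for u r i
    using that c[OF that(2)] N.I_l_closed[of "\<phi> r i" "\<phi> u \<zero>"] m.I_l_closed l.I_l_closed
    by (simp add: X_def \<phi>_mult_R)
  moreover have "X \<subseteq> \<mm>_power k \<times> linear_part k" by (auto simp: X_def)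
  ultimately have "X \<in> layer_submodules k" unfolding layer_submodules_def by blast
  then show "N \<in> (`) (\<lambda>(r, i). \<phi> r i) ` layer_submodules k" using NX by blast
next
  fix N assume "N \<in> (`) (\<lambda>(r, i). \<phi> r i) ` layer_submodules k"
  then obtain X where X: "X \<in> layer_submodules k" and NX: "N = (\<lambda>(r, i). \<phi> r i) ` X" by blast
  have X_sub: "\<mm>_power (Suc k) \<times> linear_part (Suc k) \<subseteq> X" "X \<subseteq> \<mm>_power k \<times> linear_part k"
    using X by (auto simp: layer_submodules_def)
  have X_add: "(r \<oplus> s, i \<oplus> j) \<in> X" if "(r, i) \<in> X" "(s, j) \<in> X" for r i s j
    using X that unfolding layer_submodules_def by blast
  have X_mult: "(u \<otimes> r, u \<otimes> i) \<in> X" if "u \<in> carrier R" "(r, i) \<in> X" for u r i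
    using X that unfolding layer_submodules_def by blast
  have c: "r \<in> carrier R" "i \<in> I" if "(r, i) \<in> X" for r i
    using that X_sub(2) layer_subset[of k] by auto
  have lower: "\<nn>_layer (Suc k) \<subseteq> N" and upper: "N \<subseteq> \<nn>_layer k"
    unfolding NX \<nn>_layer_def pair_set_def using X_sub by (auto intro!: imageI)
  have N_cases: thesis if "x \<in> N" "\<And>r i. (r, i) \<in> X \<Longrightarrow> x = \<phi> r i \<Longrightarrow> thesis" for x thesis
    using that unfolding NX by auto
  have N_I: "\<phi> r i \<in> N" if "(r, i) \<in> X" for r i
    unfolding NX using that by force
  have N_add: "x \<oplus>\<^bsub>S\<^esub> y \<in> N" if xy: "x \<in> N" "y \<in> N" for x y
  proof -
    obtain r i where x: "(r, i) \<in> X" "x = \<phi> r i" using xy(1) by (rule N_cases)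
    obtain s j where y: "(s, j) \<in> X" "y = \<phi> s j" using xy(2) by (rule N_cases)
    show ?thesis using N_I[OF X_add[OF x(1) y(1)]] c[OF x(1)] c[OF y(1)] by (simp add: x y \<phi>_add)
  qed
  have "ideal N S"
  proof (rule S.ideal_criterion)
    show "N \<subseteq> carrier S" using upper ideal.Icarr[OF \<nn>_layer_ideal] by blast
    show "\<zero>\<^bsub>S\<^esub> \<in> N"
      using lower additive_subgroup.zero_closed[OF ideal.axioms(1)[OF \<nn>_layer_ideal]] by blast
    show "x \<oplus>\<^bsub>S\<^esub> y \<in> N" if "x \<in> N" "y \<in> N" for x y using that by (rule N_add)
    fix y x assume y: "y \<in> carrier S" and x: "x \<in> N"
    obtain s j where y': "s \<in> carrier R" "j \<in> I" "y = \<phi> s j" using y by (rule \<phi>_cases)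
    obtain r i where x': "(r, i) \<in> X" "x = \<phi> r i" using x by (rule N_cases)
    note ri = c[OF x'(1)]
    have "\<phi> s \<zero> \<otimes>\<^bsub>S\<^esub> x \<in> N"
      using N_I[OF X_mult[OF y'(1) x'(1)]] ri y' by (simp add: x'(2) \<phi>_mult_R)
    moreover have "x \<otimes>\<^bsub>S\<^esub> \<phi> \<zero> j \<in> \<nn>_layer (Suc k)"
      unfolding x'(2) using x'(1) X_sub(2) y'(2) by (intro \<nn>_layer_mult) (auto intro: \<mm>.zero_closed)
    then have "x \<otimes>\<^bsub>S\<^esub> \<phi> \<zero> j \<in> N" using lower by blast
    then have "\<phi> \<zero> j \<otimes>\<^bsub>S\<^esub> x \<in> N" using ri y'(2) by (simp add: x'(2) S.m_comm)
    ultimately have "(\<phi> s \<zero> \<otimes>\<^bsub>S\<^esub> x) \<oplus>\<^bsub>S\<^esub> (\<phi> \<zero> j \<otimes>\<^bsub>S\<^esub> x) \<in> N" by (rule N_add)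
    moreover have "(\<phi> s \<zero> \<otimes>\<^bsub>S\<^esub> x) \<oplus>\<^bsub>S\<^esub> (\<phi> \<zero> j \<otimes>\<^bsub>S\<^esub> x) = y \<otimes>\<^bsub>S\<^esub> x"
      using ri y' by (simp add: x'(2) \<phi>_split[OF y'(1,2)] S.l_distr)
    ultimately show "y \<otimes>\<^bsub>S\<^esub> x \<in> N" by simp
  qed
  then show "N \<in> {N. ideal N S \<and> \<nn>_layer (Suc k) \<subseteq> N \<and> N \<subseteq> \<nn>_layer k}"
    using lower upper by simp
qed

lemma hilbert_fun_eq: "hilbert_fun S k = chain_sup (layer_submodules k)"
proof -
  have "hilbert_fun S k = chain_sup ((`) (\<lambda>(r, i). \<phi> r i) ` layer_submodules k)"
    unfolding S.hilbert_fun_eq_ideal_length \<nn>_power ideal_length_def ideals_between_layers ..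
  also have "\<dots> = chain_sup (layer_submodules k)"
  proof (rule chain_sup_image_inj[OF bij_betw_imp_inj_on[OF bij]])
    show "X \<subseteq> carrier R \<times> I" if "X \<in> layer_submodules k" for X
      using that layer_subset[of k] unfolding layer_submodules_def by blast
  qed
  finally show ?thesis .
qed

section \<open>The embedding dimension\<close>

lemma I_times_I: "i \<in> I \<Longrightarrow> j \<in> I \<Longrightarrow> i \<otimes> j \<in> \<mm> \<cdot> \<mm>"
  using I_subset_\<mm> by (auto intro: ideal_prod.prod)

lemma I_times_\<mm>\<mm>:
  assumes "i \<in> I" "r \<in> \<mm> \<cdot> \<mm>"
  shows "i \<otimes> r \<in> \<mm> \<cdot> I"
proof -
  have r: "r \<in> \<mm>" using assms(2) R.ideal_prod_inter[OF R.\<mm>_ideal R.\<mm>_ideal] by blast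
  then have "r \<otimes> i \<in> \<mm> \<cdot> I" using assms(1) by (rule ideal_prod.prod)
  then show ?thesis using assms(1) r \<mm>.a_Hcarr by (simp add: R.m_comm)
qed

lemma \<mm>I_ideal: "ideal (\<mm> \<cdot> I) R" and \<mm>\<mm>_ideal: "ideal (\<mm> \<cdot> \<mm>) R"
  by (rule R.ideal_prod_is_ideal; simp add: R.\<mm>_ideal I.is_ideal)+

lemma \<mm>I_subset: "\<mm> \<cdot> I \<subseteq> I" and \<mm>\<mm>_subset: "\<mm> \<cdot> \<mm> \<subseteq> \<mm>"
  using R.ideal_prod_inter[OF R.\<mm>_ideal I.is_ideal] R.ideal_prod_inter[OF R.\<mm>_ideal R.\<mm>_ideal] by auto

lemma \<nn>_square: "\<nn> \<cdot>\<^bsub>S\<^esub> \<nn> = pair_set (\<mm> \<cdot> \<mm>) (\<mm> \<cdot> I)"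
proof -
  have "\<nn> \<cdot>\<^bsub>S\<^esub> \<nn> = ideal_power S \<nn> (Suc 1)" by (simp only: ideal_power_Suc S.ideal_power_1[OF \<nn>_ideal])
  also have "\<dots> = pair_set (\<mm> \<cdot> \<mm>) (\<mm> \<cdot> I)"
    unfolding \<nn>_power \<nn>_layer_def by (simp only: ideal_power_Suc linear_part_simps R.ideal_power_1[OF R.\<mm>_ideal])
  finally show ?thesis .
qed

text \<open>The correspondence \<open>X \<mapsto> X + It\<close>, where \<open>X\<close> is an ideal of \<open>R\<close> between \<open>\<mm>\<^sup>2\<close> and \<open>\<mm>\<close>.\<close>

lemma ideal_length_constant_part:
  "ideal_length S (pair_set (\<mm> \<cdot> \<mm>) I) (pair_set \<mm> I) = ideal_length R (\<mm> \<cdot> \<mm>) \<mm>"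
proof (rule antisym)
  show "ideal_length S (pair_set (\<mm> \<cdot> \<mm>) I) (pair_set \<mm> I) \<le> ideal_length R (\<mm> \<cdot> \<mm>) \<mm>"
    unfolding ideal_length_def
  proof (rule chain_sup_mono_map[where f = "\<lambda>N. {r \<in> carrier R. \<phi> r \<zero> \<in> N}"])
    fix N assume "N \<in> {N. ideal N S \<and> pair_set (\<mm> \<cdot> \<mm>) I \<subseteq> N \<and> N \<subseteq> pair_set \<mm> I}"
    then have N: "ideal N S" "pair_set (\<mm> \<cdot> \<mm>) I \<subseteq> N" "N \<subseteq> pair_set \<mm> I" by auto
    interpret N: ideal N S by fact
    have "ideal {r \<in> carrier R. \<phi> r \<zero> \<in> N} R"
    proof (rule R.ideal_criterion)
      show "r \<oplus> s \<in> {r \<in> carrier R. \<phi> r \<zero> \<in> N}"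
        if "r \<in> {r \<in> carrier R. \<phi> r \<zero> \<in> N}" "s \<in> {r \<in> carrier R. \<phi> r \<zero> \<in> N}" for r s
        using that N.a_closed[of "\<phi> r \<zero>" "\<phi> s \<zero>"] by (simp add: \<phi>_add)
      show "s \<otimes> r \<in> {r \<in> carrier R. \<phi> r \<zero> \<in> N}"
        if "s \<in> carrier R" "r \<in> {r \<in> carrier R. \<phi> r \<zero> \<in> N}" for r s
        using that N.I_l_closed[of "\<phi> r \<zero>" "\<phi> s \<zero>"] by (simp add: \<phi>_mult_R)
    qed auto
    moreover have "\<mm> \<cdot> \<mm> \<subseteq> {r \<in> carrier R. \<phi> r \<zero> \<in> N}"
      using \<mm>\<mm>_subset by (auto intro!: subsetD[OF N(2)] pair_setI)
    moreover have "{r \<in> carrier R. \<phi> r \<zero> \<in> N} \<subseteq> \<mm>"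
      using N(3) pair_set_mem_iff[of _ \<zero> \<mm> I] \<mm>.a_subset by auto
    ultimately show "{r \<in> carrier R. \<phi> r \<zero> \<in> N} \<in> {X. ideal X R \<and> \<mm> \<cdot> \<mm> \<subseteq> X \<and> X \<subseteq> \<mm>}" by simp
  next
    fix N N' assume "N \<in> {N. ideal N S \<and> pair_set (\<mm> \<cdot> \<mm>) I \<subseteq> N \<and> N \<subseteq> pair_set \<mm> I}"
      "N' \<in> {N. ideal N S \<and> pair_set (\<mm> \<cdot> \<mm>) I \<subseteq> N \<and> N \<subseteq> pair_set \<mm> I}" and sub: "N \<subset> N'"
    then have N: "ideal N S" "pair_set (\<mm> \<cdot> \<mm>) I \<subseteq> N"
      and N': "ideal N' S" "pair_set (\<mm> \<cdot> \<mm>) I \<subseteq> N'" by auto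
    interpret N: ideal N S by fact
    interpret N': ideal N' S by fact
    obtain x where x: "x \<in> N'" "x \<notin> N" using sub by blast
    obtain r i where ri: "r \<in> carrier R" "i \<in> I" "x = \<phi> r i" using N'.a_Hcarr[OF x(1)] by (rule \<phi>_cases)
    have i0: "\<phi> \<zero> j \<in> N" if "j \<in> I" for j
      using N(2) that additive_subgroup.zero_closed[OF ideal.axioms(1)[OF \<mm>\<mm>_ideal]] by (auto intro: pair_setI)
    have "\<phi> r \<zero> = x \<oplus>\<^bsub>S\<^esub> \<phi> \<zero> (\<ominus> i)" using ri by (simp add: \<phi>_add R.r_neg)
    moreover have "\<phi> \<zero> (\<ominus> i) \<in> N'" using i0[of "\<ominus> i"] sub ri(2) by auto
    ultimately have "\<phi> r \<zero> \<in> N'" using x(1) by simp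
    moreover have "\<phi> r \<zero> \<notin> N" using x(2) i0[OF ri(2)] \<phi>_split[OF ri(1,2)] ri(3) by auto
    ultimately show "{r \<in> carrier R. \<phi> r \<zero> \<in> N} \<subset> {r \<in> carrier R. \<phi> r \<zero> \<in> N'}"
      using sub ri(1) by blast
  qed
  show "ideal_length R (\<mm> \<cdot> \<mm>) \<mm> \<le> ideal_length S (pair_set (\<mm> \<cdot> \<mm>) I) (pair_set \<mm> I)"
    unfolding ideal_length_def
  proof (rule chain_sup_mono_map[where f = "\<lambda>X. pair_set X I"])
    fix X assume X: "X \<in> {X. ideal X R \<and> \<mm> \<cdot> \<mm> \<subseteq> X \<and> X \<subseteq> \<mm>}"
    have "ideal (pair_set X I) S"
    proof (rule ideal_pair_set[OF _ I.is_ideal order_refl])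
      show "i \<otimes> j \<in> X" if "i \<in> I" "j \<in> I" for i j using I_times_I[OF that] X by blast
      show "i \<otimes> r \<in> I" if "i \<in> I" "r \<in> X" for i r
        using that X \<mm>.a_Hcarr by (intro I.I_r_closed) auto
    qed (use X in simp)
    then show "pair_set X I \<in> {N. ideal N S \<and> pair_set (\<mm> \<cdot> \<mm>) I \<subseteq> N \<and> N \<subseteq> pair_set \<mm> I}"
      using X by (simp add: pair_set_mono)
  next
    fix X X' assume *: "X \<in> {X. ideal X R \<and> \<mm> \<cdot> \<mm> \<subseteq> X \<and> X \<subseteq> \<mm>}"
      "X' \<in> {X. ideal X R \<and> \<mm> \<cdot> \<mm> \<subseteq> X \<and> X \<subseteq> \<mm>}" "X \<subset> X'"
    then obtain r where r: "r \<in> X'" "r \<notin> X" by blast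
    have c: "r \<in> carrier R" "X \<subseteq> carrier R" using r * \<mm>.a_subset by auto
    have "\<phi> r \<zero> \<in> pair_set X' I" "\<phi> r \<zero> \<notin> pair_set X I"
      using r pair_set_mem_iff[OF c(1) I_zero c(2) order_refl] by (auto intro: pair_setI)
    then show "pair_set X I \<subset> pair_set X' I" using *(3) pair_set_mono[of X X' I I] by blast
  qed
qed

text \<open>The correspondence \<open>X \<mapsto> \<mm>\<^sup>2 + Xt\<close>, where \<open>X\<close> is an ideal of \<open>R\<close> between \<open>\<mm>I\<close> and \<open>I\<close>.\<close>

lemma ideal_length_linear_part:
  "ideal_length S (pair_set (\<mm> \<cdot> \<mm>) (\<mm> \<cdot> I)) (pair_set (\<mm> \<cdot> \<mm>) I) = ideal_length R (\<mm> \<cdot> I) I"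
proof (rule antisym)
  interpret m2: ideal "\<mm> \<cdot> \<mm>" R by (rule \<mm>\<mm>_ideal)
  interpret mI: ideal "\<mm> \<cdot> I" R by (rule \<mm>I_ideal)
  show "ideal_length S (pair_set (\<mm> \<cdot> \<mm>) (\<mm> \<cdot> I)) (pair_set (\<mm> \<cdot> \<mm>) I) \<le> ideal_length R (\<mm> \<cdot> I) I"
    unfolding ideal_length_def
  proof (rule chain_sup_mono_map[where f = "\<lambda>N. {i \<in> I. \<phi> \<zero> i \<in> N}"])
    fix N assume "N \<in> {N. ideal N S \<and> pair_set (\<mm> \<cdot> \<mm>) (\<mm> \<cdot> I) \<subseteq> N \<and> N \<subseteq> pair_set (\<mm> \<cdot> \<mm>) I}"
    then have N: "ideal N S" "pair_set (\<mm> \<cdot> \<mm>) (\<mm> \<cdot> I) \<subseteq> N" by auto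
    interpret N: ideal N S by fact
    have "ideal {i \<in> I. \<phi> \<zero> i \<in> N} R"
    proof (rule R.ideal_criterion)
      show "i \<oplus> j \<in> {i \<in> I. \<phi> \<zero> i \<in> N}" if "i \<in> {i \<in> I. \<phi> \<zero> i \<in> N}" "j \<in> {i \<in> I. \<phi> \<zero> i \<in> N}" for i j
        using that N.a_closed[of "\<phi> \<zero> i" "\<phi> \<zero> j"] by (simp add: \<phi>_add)
      show "s \<otimes> i \<in> {i \<in> I. \<phi> \<zero> i \<in> N}" if "s \<in> carrier R" "i \<in> {i \<in> I. \<phi> \<zero> i \<in> N}" for s i
        using that N.I_l_closed[of "\<phi> \<zero> i" "\<phi> s \<zero>"] by (simp add: \<phi>_mult_R I.I_l_closed)
    qed auto
    moreover have "\<mm> \<cdot> I \<subseteq> {i \<in> I. \<phi> \<zero> i \<in> N}"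
      using \<mm>I_subset m2.zero_closed by (auto intro!: subsetD[OF N(2)] pair_setI)
    ultimately show "{i \<in> I. \<phi> \<zero> i \<in> N} \<in> {X. ideal X R \<and> \<mm> \<cdot> I \<subseteq> X \<and> X \<subseteq> I}" by auto
  next
    fix N N' assume "N \<in> {N. ideal N S \<and> pair_set (\<mm> \<cdot> \<mm>) (\<mm> \<cdot> I) \<subseteq> N \<and> N \<subseteq> pair_set (\<mm> \<cdot> \<mm>) I}"
      "N' \<in> {N. ideal N S \<and> pair_set (\<mm> \<cdot> \<mm>) (\<mm> \<cdot> I) \<subseteq> N \<and> N \<subseteq> pair_set (\<mm> \<cdot> \<mm>) I}" and sub: "N \<subset> N'"
    then have N: "ideal N S" "pair_set (\<mm> \<cdot> \<mm>) (\<mm> \<cdot> I) \<subseteq> N"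
      and N': "ideal N' S" "N' \<subseteq> pair_set (\<mm> \<cdot> \<mm>) I" by auto
    interpret N: ideal N S by fact
    interpret N': ideal N' S by fact
    obtain x where x: "x \<in> N'" "x \<notin> N" using sub by blast
    then obtain r i where ri: "r \<in> \<mm> \<cdot> \<mm>" "i \<in> I" "x = \<phi> r i" using N'(2) by (blast elim: pair_setE)
    have r0: "\<phi> s \<zero> \<in> N" if "s \<in> \<mm> \<cdot> \<mm>" for s
      using that mI.zero_closed by (auto intro!: subsetD[OF N(2)] pair_setI)
    have "\<phi> \<zero> i = \<phi> (\<ominus> r) \<zero> \<oplus>\<^bsub>S\<^esub> x" using ri m2.a_Hcarr by (simp add: \<phi>_add R.l_neg)
    moreover have "\<phi> (\<ominus> r) \<zero> \<in> N'" using r0[of "\<ominus> r"] sub ri(1) by auto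
    ultimately have "\<phi> \<zero> i \<in> N'" using x(1) by simp
    moreover have "\<phi> \<zero> i \<notin> N" using x(2) r0[OF ri(1)] \<phi>_split[OF m2.a_Hcarr[OF ri(1)] ri(2)] ri(3) by auto
    ultimately show "{i \<in> I. \<phi> \<zero> i \<in> N} \<subset> {i \<in> I. \<phi> \<zero> i \<in> N'}"
      using sub ri(2) by blast
  qed
  show "ideal_length R (\<mm> \<cdot> I) I \<le> ideal_length S (pair_set (\<mm> \<cdot> \<mm>) (\<mm> \<cdot> I)) (pair_set (\<mm> \<cdot> \<mm>) I)"
    unfolding ideal_length_def
  proof (rule chain_sup_mono_map[where f = "\<lambda>X. pair_set (\<mm> \<cdot> \<mm>) X"])
    fix X assume X: "X \<in> {X. ideal X R \<and> \<mm> \<cdot> I \<subseteq> X \<and> X \<subseteq> I}"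
    have "ideal (pair_set (\<mm> \<cdot> \<mm>) X) S"
    proof (rule ideal_pair_set[OF \<mm>\<mm>_ideal])
      show "i \<otimes> j \<in> \<mm> \<cdot> \<mm>" if "i \<in> I" "j \<in> X" for i j using I_times_I that X by blast
      show "i \<otimes> r \<in> X" if "i \<in> I" "r \<in> \<mm> \<cdot> \<mm>" for i r using I_times_\<mm>\<mm>[OF that] X by blast
    qed (use X in simp_all)
    then show "pair_set (\<mm> \<cdot> \<mm>) X \<in>
        {N. ideal N S \<and> pair_set (\<mm> \<cdot> \<mm>) (\<mm> \<cdot> I) \<subseteq> N \<and> N \<subseteq> pair_set (\<mm> \<cdot> \<mm>) I}"
      using X by (simp add: pair_set_mono)
  next
    fix X X' assume *: "X \<in> {X. ideal X R \<and> \<mm> \<cdot> I \<subseteq> X \<and> X \<subseteq> I}"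
      "X' \<in> {X. ideal X R \<and> \<mm> \<cdot> I \<subseteq> X \<and> X \<subseteq> I}" "X \<subset> X'"
    then obtain i where i: "i \<in> X'" "i \<notin> X" by blast
    have c: "i \<in> I" "X \<subseteq> I" using i * by auto
    have "\<phi> \<zero> i \<in> pair_set (\<mm> \<cdot> \<mm>) X'" "\<phi> \<zero> i \<notin> pair_set (\<mm> \<cdot> \<mm>) X"
      using i m2.zero_closed pair_set_mem_iff[OF R.zero_closed c(1) m2.a_subset c(2)] by (auto intro: pair_setI)
    then show "pair_set (\<mm> \<cdot> \<mm>) X \<subset> pair_set (\<mm> \<cdot> \<mm>) X'"
      using *(3) pair_set_mono[of "\<mm> \<cdot> \<mm>" "\<mm> \<cdot> \<mm>" X X'] by blast
  qed
qed

lemma \<nn>_finitely_generated: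
  assumes G: "finite G" "G \<subseteq> carrier R" "Idl G = \<mm>" and H: "finite H" "H \<subseteq> carrier R" "Idl H = I"
  shows "\<exists>T\<subseteq>carrier S. finite T \<and> Idl\<^bsub>S\<^esub> T = \<nn>"
proof -
  have GH: "G \<subseteq> \<mm>" "H \<subseteq> I" using R.genideal_self G H by auto
  define T where "T = (\<lambda>r. \<phi> r \<zero>) ` G \<union> \<phi> \<zero> ` H"
  have T: "T \<subseteq> carrier S" using G(2) GH by (auto simp: T_def)
  have TI: "ideal (Idl\<^bsub>S\<^esub> T) S" "T \<subseteq> Idl\<^bsub>S\<^esub> T" using S.genideal_ideal[OF T] S.genideal_self[OF T] .
  interpret T: ideal "Idl\<^bsub>S\<^esub> T" S by fact
  have "ideal {r \<in> carrier R. \<phi> r \<zero> \<in> Idl\<^bsub>S\<^esub> T} R"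
  proof (rule R.ideal_criterion)
    show "r \<oplus> s \<in> {r \<in> carrier R. \<phi> r \<zero> \<in> Idl\<^bsub>S\<^esub> T}"
      if "r \<in> {r \<in> carrier R. \<phi> r \<zero> \<in> Idl\<^bsub>S\<^esub> T}" "s \<in> {r \<in> carrier R. \<phi> r \<zero> \<in> Idl\<^bsub>S\<^esub> T}" for r s
      using that T.a_closed[of "\<phi> r \<zero>" "\<phi> s \<zero>"] by (simp add: \<phi>_add)
    show "s \<otimes> r \<in> {r \<in> carrier R. \<phi> r \<zero> \<in> Idl\<^bsub>S\<^esub> T}"
      if "s \<in> carrier R" "r \<in> {r \<in> carrier R. \<phi> r \<zero> \<in> Idl\<^bsub>S\<^esub> T}" for r s
      using that T.I_l_closed[of "\<phi> r \<zero>" "\<phi> s \<zero>"] by (simp add: \<phi>_mult_R)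
  qed auto
  moreover have "G \<subseteq> {r \<in> carrier R. \<phi> r \<zero> \<in> Idl\<^bsub>S\<^esub> T}" using TI(2) G(2) by (auto simp: T_def)
  ultimately have m: "\<mm> \<subseteq> {r \<in> carrier R. \<phi> r \<zero> \<in> Idl\<^bsub>S\<^esub> T}"
    unfolding G(3)[symmetric] by (rule R.genideal_minimal)
  have "ideal {i \<in> I. \<phi> \<zero> i \<in> Idl\<^bsub>S\<^esub> T} R"
  proof (rule R.ideal_criterion)
    show "i \<oplus> j \<in> {i \<in> I. \<phi> \<zero> i \<in> Idl\<^bsub>S\<^esub> T}"
      if "i \<in> {i \<in> I. \<phi> \<zero> i \<in> Idl\<^bsub>S\<^esub> T}" "j \<in> {i \<in> I. \<phi> \<zero> i \<in> Idl\<^bsub>S\<^esub> T}" for i j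
      using that T.a_closed[of "\<phi> \<zero> i" "\<phi> \<zero> j"] by (simp add: \<phi>_add)
    show "s \<otimes> i \<in> {i \<in> I. \<phi> \<zero> i \<in> Idl\<^bsub>S\<^esub> T}"
      if "s \<in> carrier R" "i \<in> {i \<in> I. \<phi> \<zero> i \<in> Idl\<^bsub>S\<^esub> T}" for s i
      using that T.I_l_closed[of "\<phi> \<zero> i" "\<phi> s \<zero>"] by (simp add: \<phi>_mult_R I.I_l_closed)
  qed auto
  moreover have "H \<subseteq> {i \<in> I. \<phi> \<zero> i \<in> Idl\<^bsub>S\<^esub> T}" using TI(2) GH(2) by (auto simp: T_def)
  ultimately have "Idl H \<subseteq> {i \<in> I. \<phi> \<zero> i \<in> Idl\<^bsub>S\<^esub> T}" by (rule R.genideal_minimal)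
  then have i: "I \<subseteq> {i \<in> I. \<phi> \<zero> i \<in> Idl\<^bsub>S\<^esub> T}" by (simp only: H(3))
  have "\<nn> \<subseteq> Idl\<^bsub>S\<^esub> T"
  proof
    fix x assume "x \<in> \<nn>"
    then obtain r j where *: "r \<in> \<mm>" "j \<in> I" "x = \<phi> r j" by (rule pair_setE)
    have "\<phi> r \<zero> \<oplus>\<^bsub>S\<^esub> \<phi> \<zero> j \<in> Idl\<^bsub>S\<^esub> T" using *(1,2) m i by (intro T.a_closed) auto
    then show "x \<in> Idl\<^bsub>S\<^esub> T" unfolding *(3) \<phi>_split[OF \<mm>.a_Hcarr[OF *(1)] *(2)] .
  qed
  moreover have "Idl\<^bsub>S\<^esub> T \<subseteq> \<nn>"
    using GH \<mm>.zero_closed by (intro S.genideal_minimal[OF \<nn>_ideal]) (auto simp: T_def intro: pair_setI)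
  ultimately show ?thesis using T G(1) H(1) by (intro exI[of _ T]) (auto simp: T_def)
qed

text \<open>The ideal \<open>\<mm>\<^sup>2 + It\<close> between \<open>\<nn>\<^sup>2 = \<mm>\<^sup>2 + \<mm>It\<close> and \<open>\<nn> = \<mm> + It\<close> splits the length of \<open>\<nn>/\<nn>\<^sup>2\<close> into those
  of \<open>I/\<mm>I\<close> and \<open>\<mm>/\<mm>\<^sup>2\<close>.\<close>

lemma embedding_dim_eq:
  assumes "noetherian_ring R"
  shows "embedding_dim S = embedding_dim R + min_gens R I"
proof -
  obtain G where G: "G \<subseteq> carrier R" "finite G" "\<mm> = Idl G"
    using noetherian_ring.finetely_gen[OF assms R.\<mm>_ideal] by blast
  obtain H where H: "H \<subseteq> carrier R" "finite H" "I = Idl H"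
    using noetherian_ring.finetely_gen[OF assms I.is_ideal] by blast
  have B: "ideal (pair_set (\<mm> \<cdot> \<mm>) I) S"
  proof (rule ideal_pair_set[OF \<mm>\<mm>_ideal I.is_ideal order_refl])
    show "i \<otimes> r \<in> I" if "i \<in> I" "r \<in> \<mm> \<cdot> \<mm>" for i r using I_times_\<mm>\<mm>[OF that] \<mm>I_subset by blast
  qed (rule I_times_I)
  have "enat (embedding_dim S) = ideal_length S (\<nn> \<cdot>\<^bsub>S\<^esub> \<nn>) \<nn>"
    unfolding embedding_dim_def S.max_ideal_eq
    using G H by (intro S.min_gens_eq_ideal_length \<nn>_finitely_generated[of G H]) auto
  also have "\<dots> = ideal_length S (\<nn> \<cdot>\<^bsub>S\<^esub> \<nn>) (pair_set (\<mm> \<cdot> \<mm>) I) + ideal_length S (pair_set (\<mm> \<cdot> \<mm>) I) \<nn>"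
  proof (rule S.ideal_length_add[OF S.ideal_prod_is_ideal[OF \<nn>_ideal \<nn>_ideal] B \<nn>_ideal])
    show "\<nn> \<cdot>\<^bsub>S\<^esub> \<nn> \<subseteq> pair_set (\<mm> \<cdot> \<mm>) I" unfolding \<nn>_square by (rule pair_set_mono[OF order_refl \<mm>I_subset])
    show "pair_set (\<mm> \<cdot> \<mm>) I \<subseteq> \<nn>" by (rule pair_set_mono[OF \<mm>\<mm>_subset order_refl])
  qed
  also have "\<dots> = ideal_length R (\<mm> \<cdot> I) I + ideal_length R (\<mm> \<cdot> \<mm>) \<mm>"
    unfolding \<nn>_square ideal_length_linear_part ideal_length_constant_part ..
  also have "\<dots> = enat (min_gens R I) + enat (embedding_dim R)"
    unfolding embedding_dim_def R.max_ideal_eq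
    using R.min_gens_eq_ideal_length[of I] R.min_gens_eq_ideal_length[of \<mm>] G H by metis
  finally show ?thesis by simp
qed

end

section \<open>The Krull dimension\<close>

context quadratic_extension
begin

definition contraction :: "'c set \<Rightarrow> 'a set"
  where "contraction Q = {r \<in> carrier R. \<phi> r \<zero> \<in> Q}"

lemma contraction_mono: "Q \<subseteq> Q' \<Longrightarrow> contraction Q \<subseteq> contraction Q'"
  by (auto simp: contraction_def)

lemma contraction_ideal:
  assumes "ideal Q S"
  shows "ideal (contraction Q) R"
proof (rule R.ideal_criterion)
  interpret Q: ideal Q S by fact
  show "contraction Q \<subseteq> carrier R" by (auto simp: contraction_def)
  show "\<zero> \<in> contraction Q" by (simp add: contraction_def)
  show "r \<oplus> s \<in> contraction Q" if "r \<in> contraction Q" "s \<in> contraction Q" for r s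
    using that Q.a_closed[of "\<phi> r \<zero>" "\<phi> s \<zero>"] by (simp add: contraction_def \<phi>_add)
  show "s \<otimes> r \<in> contraction Q" if "s \<in> carrier R" "r \<in> contraction Q" for r s
    using that Q.I_l_closed[of "\<phi> r \<zero>" "\<phi> s \<zero>"] by (simp add: contraction_def \<phi>_mult_R)
qed

lemma contraction_primeideal:
  assumes "primeideal Q S"
  shows "primeideal (contraction Q) R"
proof (rule primeidealI)
  interpret Q: primeideal Q S by fact
  show "ideal (contraction Q) R" by (rule contraction_ideal[OF Q.is_ideal])
  show "cring R" by (rule R.is_cring)
  have "\<one> \<notin> contraction Q" using Q.one_imp_carrier Q.I_notcarr by (auto simp: contraction_def \<phi>_one)
  then show "carrier R \<noteq> contraction Q" by auto
  show "r \<in> contraction Q \<or> s \<in> contraction Q"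
    if "r \<in> carrier R" "s \<in> carrier R" "r \<otimes> s \<in> contraction Q" for r s
    using that Q.I_prime[of "\<phi> r \<zero>" "\<phi> s \<zero>"] by (simp add: contraction_def \<phi>_mult_R)
qed

lemma ex_conjugate:
  assumes "x \<in> carrier S"
  obtains y c n where "y \<in> carrier S" "c \<in> carrier R" "n \<in> carrier R"
    "x \<oplus>\<^bsub>S\<^esub> y = \<phi> c \<zero>" "x \<otimes>\<^bsub>S\<^esub> y = \<phi> n \<zero>"
proof -
  obtain r i where ri: "r \<in> carrier R" "i \<in> I" "x = \<phi> r i" using assms by (rule \<phi>_cases)
  show thesis
    by (rule that[OF _ _ _ conjugate[OF ri(1,2), folded ri(3)]]) (use ri in simp_all)
qed

text \<open>Incomparability. Let \<open>x \<in> Q - P\<close> and let \<open>y\<close> be its conjugate. The norm \<open>xy\<close> is in \<open>Q \<inter> R = P \<inter> R\<close>, so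
  \<open>y \<in> P\<close>. Then the trace \<open>x + y\<close> is in \<open>Q \<inter> R = P \<inter> R\<close> as well, which gives \<open>x \<in> P\<close>.\<close>

lemma contraction_strict:
  assumes P: "primeideal P S" and Q: "primeideal Q S" and PQ: "P \<subset> Q"
  shows "contraction P \<subset> contraction Q"
proof
  interpret P: primeideal P S by fact
  interpret Q: primeideal Q S by fact
  show "contraction P \<subseteq> contraction Q" using PQ by (intro contraction_mono) auto
  show "contraction P \<noteq> contraction Q"
  proof
    assume eq: "contraction P = contraction Q"
    have lift: "\<phi> r \<zero> \<in> P" if "r \<in> carrier R" "\<phi> r \<zero> \<in> Q" for r
    proof -
      have "r \<in> contraction P" unfolding eq using that by (simp add: contraction_def)
      then show ?thesis by (simp add: contraction_def)
    qed
    obtain x where x: "x \<in> Q" "x \<notin> P" using PQ by blast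
    have xc: "x \<in> carrier S" using x(1) by (rule Q.a_Hcarr)
    obtain y c n where y: "y \<in> carrier S" and c: "c \<in> carrier R" and n: "n \<in> carrier R"
      and sum: "x \<oplus>\<^bsub>S\<^esub> y = \<phi> c \<zero>" and prod: "x \<otimes>\<^bsub>S\<^esub> y = \<phi> n \<zero>"
      using xc by (rule ex_conjugate)
    have "x \<otimes>\<^bsub>S\<^esub> y \<in> P" unfolding prod
      using lift[OF n] Q.I_r_closed[OF x(1) y] unfolding prod by blast
    then have yP: "y \<in> P" using P.I_prime[OF xc y] x(2) by blast
    then have "x \<oplus>\<^bsub>S\<^esub> y \<in> Q" using x(1) PQ by auto
    then have "x \<oplus>\<^bsub>S\<^esub> y \<in> P" unfolding sum by (rule lift[OF c])
    then have "(x \<oplus>\<^bsub>S\<^esub> y) \<ominus>\<^bsub>S\<^esub> y \<in> P" using yP by (rule S.ideal_minus_closed[OF P.is_ideal])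
    moreover have "(x \<oplus>\<^bsub>S\<^esub> y) \<ominus>\<^bsub>S\<^esub> y = x" using xc y by algebra
    ultimately show False using x(2) by simp
  qed
qed

text \<open>Lying over and going up in one statement. An ideal \<open>Q \<supseteq> Q\<^sub>0\<close> maximal among those avoiding \<open>R - p\<close> is prime
  and contracts into \<open>p\<close>. If \<open>y \<in> p\<close> were not in \<open>Q\<close>, some \<open>r \<in> R - p\<close> would have the form \<open>q + sy\<close> with
  \<open>q \<in> Q\<close>. With the conjugate \<open>t\<close> of \<open>s\<close>, the product \<open>(r - sy)(r - ty) = r\<^sup>2 - y((s + t)r - (st)y)\<close> is in
  \<open>Q \<inter> R \<subseteq> p\<close>, and so \<open>r\<^sup>2 \<in> p\<close>.\<close>

lemma prime_lying_over:
  assumes p: "primeideal p R" and Q0: "ideal Q\<^sub>0 S" "contraction Q\<^sub>0 \<subseteq> p"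
  obtains Q where "primeideal Q S" "Q\<^sub>0 \<subseteq> Q" "contraction Q = p"
proof -
  interpret p: primeideal p R by fact
  define T where "T = {\<phi> r \<zero> | r. r \<in> carrier R \<and> r \<notin> p}"
  have T_I: "\<phi> r \<zero> \<in> T" if "r \<in> carrier R" "r \<notin> p" for r using that by (auto simp: T_def)
  have "Q\<^sub>0 \<inter> T = {}" using Q0(2) by (auto simp: T_def contraction_def)
  then obtain Q where Q: "ideal Q S" "Q\<^sub>0 \<subseteq> Q" "Q \<inter> T = {}"
    and max: "\<And>Q'. ideal Q' S \<Longrightarrow> Q \<subseteq> Q' \<Longrightarrow> Q' \<inter> T = {} \<Longrightarrow> Q' = Q"
    using S.ex_ideal_maximal_avoiding[OF Q0(1)] by metis
  interpret Q: ideal Q S by fact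
  have "primeideal Q S"
  proof (rule S.maximal_avoiding_primeideal[OF Q(1,3) max])
    have "\<one> \<notin> p" using p.one_imp_carrier p.I_notcarr by auto
    then show "\<one>\<^bsub>S\<^esub> \<in> T" using T_I[of \<one>] by (simp add: \<phi>_one)
    show "s \<otimes>\<^bsub>S\<^esub> t \<in> T" if st: "s \<in> T" "t \<in> T" for s t
    proof -
      obtain u v where *: "u \<in> carrier R" "u \<notin> p" "s = \<phi> u \<zero>" "v \<in> carrier R" "v \<notin> p" "t = \<phi> v \<zero>"
        using st by (auto simp: T_def)
      then have "u \<otimes> v \<notin> p" using p.I_prime by blast
      then show ?thesis using T_I[of "u \<otimes> v"] * by (simp add: \<phi>_mult_R)
    qed
  qed
  moreover have "contraction Q = p"
  proof
    show "contraction Q \<subseteq> p" using Q(3) by (auto simp: T_def contraction_def)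
    show "p \<subseteq> contraction Q"
    proof (rule subsetI, rule ccontr)
      fix y assume y: "y \<in> p" "y \<notin> contraction Q"
      have yc: "y \<in> carrier R" using y(1) by (rule p.a_Hcarr)
      then have ey: "\<phi> y \<zero> \<in> carrier S" "\<phi> y \<zero> \<notin> Q" using y(2) by (auto simp: contraction_def)
      obtain q s where qs: "q \<in> Q" "s \<in> carrier S" "q \<oplus>\<^bsub>S\<^esub> s \<otimes>\<^bsub>S\<^esub> \<phi> y \<zero> \<in> T"
        using S.maximal_avoiding_meets[OF Q(1) max ey] by blast
      then obtain r where r: "r \<in> carrier R" "r \<notin> p" "q \<oplus>\<^bsub>S\<^esub> s \<otimes>\<^bsub>S\<^esub> \<phi> y \<zero> = \<phi> r \<zero>"
        by (auto simp: T_def)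
      obtain t c n where t: "t \<in> carrier S" and c: "c \<in> carrier R" and n: "n \<in> carrier R"
        and sum: "s \<oplus>\<^bsub>S\<^esub> t = \<phi> c \<zero>" and prod: "s \<otimes>\<^bsub>S\<^esub> t = \<phi> n \<zero>"
        using qs(2) by (rule ex_conjugate)
      \<comment> \<open>The abbreviations keep the ring identity below free of \<open>\<phi>\<close>.\<close>
      define e d where "e = \<phi> r \<zero>" and "d = \<phi> y \<zero>"
      have ed: "e \<in> carrier S" "d \<in> carrier S" using r(1) ey(1) by (auto simp: e_def d_def)
      have qc: "q \<in> carrier S" using qs(1) by (rule Q.a_Hcarr)
      have e_eq: "q \<oplus>\<^bsub>S\<^esub> s \<otimes>\<^bsub>S\<^esub> d = e" using r(3) by (simp only: e_def d_def)
      have "q \<otimes>\<^bsub>S\<^esub> (e \<ominus>\<^bsub>S\<^esub> t \<otimes>\<^bsub>S\<^esub> d) \<in> Q" using ed t by (intro Q.I_r_closed[OF qs(1)]) simp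
      moreover have "q \<otimes>\<^bsub>S\<^esub> (e \<ominus>\<^bsub>S\<^esub> t \<otimes>\<^bsub>S\<^esub> d) =
          e \<otimes>\<^bsub>S\<^esub> e \<ominus>\<^bsub>S\<^esub> d \<otimes>\<^bsub>S\<^esub> ((s \<oplus>\<^bsub>S\<^esub> t) \<otimes>\<^bsub>S\<^esub> e \<ominus>\<^bsub>S\<^esub> (s \<otimes>\<^bsub>S\<^esub> t) \<otimes>\<^bsub>S\<^esub> d)"
        unfolding e_eq[symmetric] using qc qs(2) t ed(2) by algebra
      moreover have "e \<otimes>\<^bsub>S\<^esub> e \<ominus>\<^bsub>S\<^esub> d \<otimes>\<^bsub>S\<^esub> ((s \<oplus>\<^bsub>S\<^esub> t) \<otimes>\<^bsub>S\<^esub> e \<ominus>\<^bsub>S\<^esub> (s \<otimes>\<^bsub>S\<^esub> t) \<otimes>\<^bsub>S\<^esub> d) =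
          \<phi> (r \<otimes> r \<ominus> y \<otimes> (c \<otimes> r \<ominus> n \<otimes> y)) \<zero>"
      proof -
        have minus: "\<phi> u \<zero> \<ominus>\<^bsub>S\<^esub> \<phi> v \<zero> = \<phi> (u \<ominus> v) \<zero>" if "u \<in> carrier R" "v \<in> carrier R" for u v
        proof -
          have "\<phi> (u \<ominus> v) \<zero> \<oplus>\<^bsub>S\<^esub> \<phi> v \<zero> = \<phi> (u \<ominus> v \<oplus> v) \<zero>" using that by (simp add: \<phi>_add)
          also have "u \<ominus> v \<oplus> v = u" using that by algebra
          finally have *: "\<phi> u \<zero> = \<phi> (u \<ominus> v) \<zero> \<oplus>\<^bsub>S\<^esub> \<phi> v \<zero>" ..
          have "\<phi> (u \<ominus> v) \<zero> \<in> carrier S" "\<phi> v \<zero> \<in> carrier S" using that by auto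
          then show ?thesis unfolding * by algebra
        qed
        show ?thesis
          unfolding sum prod e_def d_def using r(1) yc c n by (simp add: \<phi>_mult_R minus)
      qed
      ultimately have "\<phi> (r \<otimes> r \<ominus> y \<otimes> (c \<otimes> r \<ominus> n \<otimes> y)) \<zero> \<in> Q" by simp
      then have "r \<otimes> r \<ominus> y \<otimes> (c \<otimes> r \<ominus> n \<otimes> y) \<in> p"
        using r(1) yc c n \<open>contraction Q \<subseteq> p\<close> by (auto simp: contraction_def)
      moreover have "y \<otimes> (c \<otimes> r \<ominus> n \<otimes> y) \<in> p" using r(1) yc c n by (intro p.I_r_closed[OF y(1)]) simp
      ultimately have "(r \<otimes> r \<ominus> y \<otimes> (c \<otimes> r \<ominus> n \<otimes> y)) \<oplus> y \<otimes> (c \<otimes> r \<ominus> n \<otimes> y) \<in> p" by simp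
      moreover have "(r \<otimes> r \<ominus> y \<otimes> (c \<otimes> r \<ominus> n \<otimes> y)) \<oplus> y \<otimes> (c \<otimes> r \<ominus> n \<otimes> y) = r \<otimes> r"
        using r(1) yc c n by algebra
      ultimately show False using p.I_prime[OF r(1,1)] r(2) by simp
    qed
  qed
  ultimately show thesis using that Q(2) by blast
qed

text \<open>Contraction sends chains of primes of \<open>S\<close> to chains of primes of \<open>R\<close>, and going up lifts chains back.\<close>

lemma krull_dim_eq: "krull_dim S = krull_dim R"
proof (rule antisym)
  show "krull_dim S \<le> krull_dim R"
    unfolding krull_dim_def
    by (rule chain_sup_mono_map[where f = contraction]) (simp_all add: contraction_primeideal contraction_strict)
  show "krull_dim R \<le> krull_dim S"
    unfolding krull_dim_def[of R] chain_sup_le_iff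
  proof (intro allI impI)
    fix F n assume F: "strict_chain {P. primeideal P R} F n"
    have "\<exists>G. strict_chain {P. primeideal P S} G k \<and> contraction (G k) = F k" if "k \<le> n" for k
      using that
    proof (induction k)
      case 0
      have F0: "primeideal (F 0) R" using F by (auto simp: strict_chain_def)
      interpret F0: primeideal "F 0" R by fact
      have "contraction {\<zero>\<^bsub>S\<^esub>} \<subseteq> F 0"
      proof
        fix r assume "r \<in> contraction {\<zero>\<^bsub>S\<^esub>}"
        then have "r \<in> carrier R" "\<phi> r \<zero> = \<phi> \<zero> \<zero>" by (auto simp: contraction_def)
        then have "r = \<zero>" by (simp del: \<phi>_zero)
        then show "r \<in> F 0" by simp
      qed
      then obtain Q where Q: "primeideal Q S" "contraction Q = F 0"
        using prime_lying_over[OF F0 S.zeroideal] by blast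
      then show ?case by (intro exI[of _ "\<lambda>_. Q"]) (simp add: strict_chain_def)
    next
      case (Suc k)
      then obtain G where G: "strict_chain {P. primeideal P S} G k" "contraction (G k) = F k" by auto
      have Fk: "primeideal (F (Suc k)) R" "F k \<subset> F (Suc k)"
        using F Suc.prems by (auto simp: strict_chain_def)
      have "ideal (G k) S" using G(1) by (auto simp: strict_chain_def intro: primeideal.axioms)
      then obtain Q where Q: "primeideal Q S" "G k \<subseteq> Q" "contraction Q = F (Suc k)"
        using prime_lying_over[OF Fk(1)] G(2) Fk(2) by blast
      have "G k \<noteq> Q" using Q(3) G(2) Fk(2) by auto
      then have "strict_chain {P. primeideal P S} (G(Suc k := Q)) (Suc k)"
        using G(1) Q(1,2) by (auto simp: strict_chain_def le_Suc_eq less_Suc_eq)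
      moreover have "contraction ((G(Suc k := Q)) (Suc k)) = F (Suc k)" using Q(3) by simp
      ultimately show ?case by blast
    qed
    then show "enat n \<le> krull_dim S" unfolding krull_dim_def using strict_chain_le_chain_sup by blast
  qed
qed

end

section \<open>The quotients of the Rees algebra\<close>

lemma (in cring) ideal_power_add:
  assumes "ideal J R"
  shows "ideal_power R J (m + n) = ideal_power R J m \<cdot> ideal_power R J n"
proof -
  interpret M: comm_monoid "ideals_set R" by (rule ideals_set_is_comm_monoid)
  have "J \<in> carrier (ideals_set R)" using assms by (simp add: ideals_set_def)
  from M.nat_pow_mult[OF this, of m n] show ?thesis by (simp add: ideals_set_def)
qed

lemma (in ring) ideal_finsum_closed:
  assumes "ideal J R" "finite A" "\<And>x. x \<in> A \<Longrightarrow> f x \<in> J"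
  shows "finsum R f A \<in> J"
proof -
  interpret J: ideal J R by fact
  show ?thesis
    using assms(2,3)
  proof (induction A rule: finite_induct)
    case (insert x A)
    then have "f \<in> A \<rightarrow> carrier R" "f x \<in> carrier R" by auto
    then show ?case using insert by simp
  qed simp
qed

lemma (in ideal) coset_add_absorb:
  assumes "j \<in> I" "x \<in> carrier R"
  shows "I +> (j \<oplus> x) = I +> x"
proof -
  have "j \<oplus> x \<in> I +> x" using assms(1) by (auto simp: a_r_coset_def')
  then show ?thesis using a_repr_independence[OF _ assms(2) a_subgroup] by simp
qed

lemma (in ideal) coset_eq_imp_add:
  assumes "I +> x = I +> y" "x \<in> carrier R"
  obtains j where "j \<in> I" "x = j \<oplus> y"
proof -
  have "x \<in> I +> y" using a_rcos_self[OF assms(2)] assms(1) by simp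
  then show thesis using that by (auto simp: a_r_coset_def')
qed

locale rees_quotient = local_cring R \<mm> + I: ideal I R for R (structure) and \<mm> and I +
  fixes a b :: 'a
  assumes a: "a \<in> carrier R" and b: "b \<in> carrier R" and I_proper: "I \<noteq> carrier R"
begin

sublocale U: UP_cring R "UP R" by unfold_locales

abbreviation "P \<equiv> UP R"
abbreviation "X \<equiv> monom P \<one> 1"
abbreviation "const r \<equiv> monom P r 0"
abbreviation "A \<equiv> rees_algebra R I"
abbreviation "q \<equiv> quad_poly R a b"
abbreviation "Q \<equiv> cgenideal P q \<inter> carrier A"

lemma I_power_ideal: "ideal (ideal_power R I n) R"
  by (rule ideal_power_ideal[OF I.is_ideal])

lemma carrier_A: "carrier A = {p \<in> carrier P. \<forall>n. coeff P p n \<in> ideal_power R I n}"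
  by (simp add: rees_algebra_def)

lemma A_simps [simp]: "add A = add P" "mult A = mult P" "zero A = zero P" "one A = one P"
  by (simp_all add: rees_algebra_def)

lemma A_carrier_subset: "carrier A \<subseteq> carrier P"
  by (auto simp: carrier_A)

lemma monom_in_A:
  assumes "c \<in> ideal_power R I n"
  shows "monom P c n \<in> carrier A"
proof -
  have "c \<in> carrier R" using assms ideal.Icarr[OF I_power_ideal] by blast
  moreover have "\<zero> \<in> ideal_power R I m" for m
    by (rule additive_subgroup.zero_closed[OF ideal.axioms(1)[OF I_power_ideal]])
  ultimately show ?thesis using assms by (simp add: carrier_A U.coeff_monom)
qed

lemma subring_A: "subring (carrier A) P"
proof (rule U.P.subringI)
  show "carrier A \<subseteq> carrier P" by (rule A_carrier_subset)
  have "const \<one> \<in> carrier A" by (rule monom_in_A) (simp only: ideal_power_0 one_closed)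
  then show "\<one>\<^bsub>P\<^esub> \<in> carrier A" by (simp add: U.monom_one)
  show "\<ominus>\<^bsub>P\<^esub> f \<in> carrier A" if "f \<in> carrier A" for f
    using that additive_subgroup.a_inv_closed[OF ideal.axioms(1)[OF I_power_ideal]]
    by (simp add: carrier_A)
  show "f \<oplus>\<^bsub>P\<^esub> g \<in> carrier A" if "f \<in> carrier A" "g \<in> carrier A" for f g
    using that additive_subgroup.a_closed[OF ideal.axioms(1)[OF I_power_ideal]]
    by (simp add: carrier_A)
  show "f \<otimes>\<^bsub>P\<^esub> g \<in> carrier A" if fg: "f \<in> carrier A" "g \<in> carrier A" for f g
  proof -
    have "(\<Oplus>i\<in>{..n}. coeff P f i \<otimes> coeff P g (n - i)) \<in> ideal_power R I n" for n
    proof (rule ideal_finsum_closed[OF I_power_ideal finite_atMost])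
      fix i assume i: "i \<in> {..n}"
      have "coeff P f i \<otimes> coeff P g (n - i) \<in> ideal_power R I i \<cdot> ideal_power R I (n - i)"
        using fg by (intro ideal_prod.prod) (simp_all add: carrier_A)
      also have "\<dots> = ideal_power R I n"
        using i by (simp add: ideal_power_add[OF I.is_ideal, symmetric])
      finally show "coeff P f i \<otimes> coeff P g (n - i) \<in> ideal_power R I n" .
    qed
    then show ?thesis using fg by (simp add: carrier_A)
  qed
qed

sublocale A: cring A
proof -
  have "cring (P\<lparr>carrier := carrier A\<rparr>)"
    using U.P.subcring_iff[OF A_carrier_subset] U.P.subcringI'[OF subring_A] by blast
  moreover have "P\<lparr>carrier := carrier A\<rparr> = A" by (simp add: rees_algebra_def)
  ultimately show "cring A" by simp
qed

lemma const_mult: "r \<in> carrier R \<Longrightarrow> s \<in> carrier R \<Longrightarrow> const (r \<otimes> s) = const r \<otimes>\<^bsub>P\<^esub> const s"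
  using U.monom_mult[of r s 0 0] by simp

lemma const_minus: "r \<in> carrier R \<Longrightarrow> s \<in> carrier R \<Longrightarrow> const (r \<ominus> s) = const r \<ominus>\<^bsub>P\<^esub> const s"
  by (simp add: a_minus_def)

lemma monom_1_eq: "r \<in> carrier R \<Longrightarrow> monom P r 1 = const r \<otimes>\<^bsub>P\<^esub> X"
  using U.monom_mult[of r \<one> 0 1] by simp

lemma q_eq: "q = X \<otimes>\<^bsub>P\<^esub> X \<oplus>\<^bsub>P\<^esub> const a \<otimes>\<^bsub>P\<^esub> X \<oplus>\<^bsub>P\<^esub> const b"
proof -
  have "monom P \<one> 2 = X \<otimes>\<^bsub>P\<^esub> X" using U.monom_mult[of \<one> \<one> 1 1] by (simp add: numeral_2_eq_2)
  then show ?thesis using a unfolding quad_poly_def monom_1_eq[OF a] by simp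
qed

lemma q_closed: "q \<in> carrier P"
  using a b by (simp add: quad_poly_def)

lemma Q_ideal: "ideal Q A"
proof (rule A.ideal_criterion)
  interpret C: ideal "cgenideal P q" P by (rule U.P.cgenideal_ideal[OF q_closed])
  show "\<zero>\<^bsub>A\<^esub> \<in> Q" using A.zero_closed C.zero_closed by simp
  show "f \<oplus>\<^bsub>A\<^esub> g \<in> Q" if "f \<in> Q" "g \<in> Q" for f g
    using that A.a_closed[of f g] by simp
  show "r \<otimes>\<^bsub>A\<^esub> f \<in> Q" if "r \<in> carrier A" "f \<in> Q" for r f
    using that A.m_closed[of r f] A_carrier_subset C.I_l_closed[of f r] by auto
qed simp

sublocale Q: ideal Q A by (rule Q_ideal)

lemma monom_times_q:
  assumes "c \<in> carrier R"
  shows "monom P c n \<otimes>\<^bsub>P\<^esub> q = monom P c (n + 2) \<oplus>\<^bsub>P\<^esub> monom P (c \<otimes> a) (n + 1) \<oplus>\<^bsub>P\<^esub> monom P (c \<otimes> b) n"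
  using assms a b U.monom_mult[of c \<one> n 2] U.monom_mult[of c a n 1] U.monom_mult[of c b n 0]
  unfolding quad_poly_def by (simp add: U.P.r_distr)

lemma monom_times_q_in_Q:
  assumes c: "c \<in> ideal_power R I (n + 2)"
  shows "monom P c n \<otimes>\<^bsub>P\<^esub> q \<in> Q"
proof
  have cc: "c \<in> carrier R" using c ideal.Icarr[OF I_power_ideal] by blast
  show "monom P c n \<otimes>\<^bsub>P\<^esub> q \<in> cgenideal P q"
    using cc unfolding cgenideal_def by auto
  have c1: "c \<in> ideal_power R I (n + 1)" and c0: "c \<in> ideal_power R I n"
    using c ideal_prod_inter[OF I_power_ideal I.is_ideal, of "n + 1"]
      ideal_prod_inter[OF I_power_ideal I.is_ideal, of n]
    by (auto simp only: add_2_eq_Suc' add_Suc_right ideal_power_Suc Suc_eq_plus1[symmetric])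
  have "c \<otimes> a \<in> ideal_power R I (n + 1)" using c1 a by (rule ideal.I_r_closed[OF I_power_ideal])
  moreover have "c \<otimes> b \<in> ideal_power R I n" using c0 b by (rule ideal.I_r_closed[OF I_power_ideal])
  ultimately have "monom P c (n + 2) \<oplus>\<^bsub>A\<^esub> monom P (c \<otimes> a) (n + 1) \<oplus>\<^bsub>A\<^esub> monom P (c \<otimes> b) n \<in> carrier A"
    using c by (intro A.a_closed monom_in_A)
  then show "monom P c n \<otimes>\<^bsub>P\<^esub> q \<in> carrier A" unfolding monom_times_q[OF cc] by simp
qed

text \<open>As \<open>q\<close> is monic of degree 2, the coefficient of \<open>hq\<close> in degree \<open>deg h + 2\<close> is the leading coefficient of
  \<open>h\<close>.\<close>

lemma q_multiple_of_degree_le_1: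
  assumes f: "f \<in> cgenideal P q" and deg: "\<And>n. n \<ge> 2 \<Longrightarrow> coeff P f n = \<zero>"
  shows "f = \<zero>\<^bsub>P\<^esub>"
proof -
  obtain h where h: "h \<in> carrier P" "f = h \<otimes>\<^bsub>P\<^esub> q" using f unfolding cgenideal_def by blast
  let ?d = "deg R h"
  have "f = monom P \<one> 2 \<otimes>\<^bsub>P\<^esub> h \<oplus>\<^bsub>P\<^esub> monom P a 1 \<otimes>\<^bsub>P\<^esub> h \<oplus>\<^bsub>P\<^esub> monom P b 0 \<otimes>\<^bsub>P\<^esub> h"
    unfolding h(2) U.P.m_comm[OF h(1) q_closed] unfolding quad_poly_def
    using a b h(1) by (simp add: U.P.l_distr)
  then have "coeff P f (?d + 2) = coeff P (monom P \<one> 2 \<otimes>\<^bsub>P\<^esub> h) (?d + 2) \<oplus>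
      coeff P (monom P a 1 \<otimes>\<^bsub>P\<^esub> h) ((?d + 1) + 1) \<oplus> coeff P (monom P b 0 \<otimes>\<^bsub>P\<^esub> h) ((?d + 2) + 0)"
    using a b h(1) by (simp del: U.coeff_mult)
  also have "\<dots> = coeff P h ?d"
    unfolding U.coeff_monom_mult[OF one_closed h(1)] U.coeff_monom_mult[OF a h(1)] U.coeff_monom_mult[OF b h(1)]
    using a b h(1) by (simp add: U.deg_aboveD)
  finally have "coeff P h ?d = \<zero>" using deg by simp
  then have "h = \<zero>\<^bsub>P\<^esub>" using U.lcoeff_nonzero[OF _ h(1)] by blast
  then show ?thesis using h(2) q_closed by simp
qed

definition linear :: "'a \<Rightarrow> 'a \<Rightarrow> nat \<Rightarrow> 'a"
  where "linear r i = const r \<oplus>\<^bsub>P\<^esub> monom P i 1"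

lemma linear_in_A: "r \<in> carrier R \<Longrightarrow> i \<in> I \<Longrightarrow> linear r i \<in> carrier A"
  using A.a_closed[OF monom_in_A monom_in_A, of r 0 i 1]
  by (simp only: linear_def ideal_power_0 ideal_power_1[OF I.is_ideal] A_simps)

lemma linear_add:
  assumes "r \<in> carrier R" "s \<in> carrier R" "i \<in> I" "j \<in> I"
  shows "linear r i \<oplus>\<^bsub>P\<^esub> linear s j = linear (r \<oplus> s) (i \<oplus> j)"
  using assms by (simp add: linear_def U.P.a_ac)

text \<open>Replace \<open>t\<^sup>2\<close> by \<open>q - at - b\<close> in \<open>(r + it)(s + jt)\<close>.\<close>

lemma linear_mult:
  assumes r: "r \<in> carrier R" and s: "s \<in> carrier R" and i: "i \<in> I" and j: "j \<in> I"
  shows "linear r i \<otimes>\<^bsub>P\<^esub> linear s j = monom P (i \<otimes> j) 0 \<otimes>\<^bsub>P\<^esub> q \<oplus>\<^bsub>P\<^esub>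
    linear (r \<otimes> s \<ominus> b \<otimes> (i \<otimes> j)) (r \<otimes> j \<oplus> s \<otimes> i \<ominus> a \<otimes> (i \<otimes> j))"
proof -
  have c: "i \<in> carrier R" "j \<in> carrier R" using i j by auto
  \<comment> \<open>Opaque names, so that the identity is one between elements of the commutative ring \<open>R[t]\<close>.\<close>
  define x r' s' i' j' a' b' where defs: "x = X" "r' = const r" "s' = const s" "i' = const i"
    "j' = const j" "a' = const a" "b' = const b"
  have cl: "x \<in> carrier P" "r' \<in> carrier P" "s' \<in> carrier P" "i' \<in> carrier P" "j' \<in> carrier P"
    "a' \<in> carrier P" "b' \<in> carrier P"
    unfolding defs using r s c a b by (auto intro: U.monom_closed)
  have "(r' \<oplus>\<^bsub>P\<^esub> i' \<otimes>\<^bsub>P\<^esub> x) \<otimes>\<^bsub>P\<^esub> (s' \<oplus>\<^bsub>P\<^esub> j' \<otimes>\<^bsub>P\<^esub> x) =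
      (i' \<otimes>\<^bsub>P\<^esub> j') \<otimes>\<^bsub>P\<^esub> (x \<otimes>\<^bsub>P\<^esub> x \<oplus>\<^bsub>P\<^esub> a' \<otimes>\<^bsub>P\<^esub> x \<oplus>\<^bsub>P\<^esub> b') \<oplus>\<^bsub>P\<^esub>
      ((r' \<otimes>\<^bsub>P\<^esub> s' \<ominus>\<^bsub>P\<^esub> b' \<otimes>\<^bsub>P\<^esub> (i' \<otimes>\<^bsub>P\<^esub> j')) \<oplus>\<^bsub>P\<^esub>
       (r' \<otimes>\<^bsub>P\<^esub> j' \<oplus>\<^bsub>P\<^esub> s' \<otimes>\<^bsub>P\<^esub> i' \<ominus>\<^bsub>P\<^esub> a' \<otimes>\<^bsub>P\<^esub> (i' \<otimes>\<^bsub>P\<^esub> j')) \<otimes>\<^bsub>P\<^esub> x)"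
    using cl by algebra
  then show ?thesis
    unfolding defs linear_def q_eq
    using r s c a b by (simp only: monom_1_eq const_mult const_minus U.monom_add m_closed minus_closed a_closed)
qed

text \<open>Division by \<open>q\<close> inside the Rees algebra: if the leading term of \<open>f\<close> is \<open>ct\<^sup>n\<close> with \<open>n \<ge> 2\<close>, subtract
  \<open>ct\<^sup>n\<^sup>-\<^sup>2q\<close>. All its coefficients are multiples of \<open>c \<in> I\<^sup>n\<close>, so it stays in the Rees algebra.\<close>

lemma linear_reduction:
  assumes "f \<in> carrier A" "\<And>k. k > n \<Longrightarrow> coeff P f k = \<zero>"
  shows "\<exists>g\<in>Q. \<exists>r\<in>carrier R. \<exists>i\<in>I. f = g \<oplus>\<^bsub>P\<^esub> linear r i"
  using assms
proof (induction n arbitrary: f rule: less_induct)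
  case (less n)
  have fP: "f \<in> carrier P" using less.prems(1) A_carrier_subset by blast
  have co: "coeff P f k \<in> ideal_power R I k" for k using less.prems(1) by (simp add: carrier_A)
  show ?case
  proof (cases "n \<le> 1")
    case True
    have c1: "coeff P f 1 \<in> I" using co[of 1] by (simp only: ideal_power_1[OF I.is_ideal])
    have c0: "coeff P f 0 \<in> carrier R" using fP by simp
    have "f = \<zero>\<^bsub>P\<^esub> \<oplus>\<^bsub>P\<^esub> linear (coeff P f 0) (coeff P f 1)"
    proof (rule U.up_eqI)
      fix k :: nat
      consider "k = 0" | "k = 1" | "k > 1" by linarith
      then show "coeff P f k = coeff P (\<zero>\<^bsub>P\<^esub> \<oplus>\<^bsub>P\<^esub> linear (coeff P f 0) (coeff P f 1)) k"
        using fP True less.prems(2)[of k] by cases (simp_all add: linear_def)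
    qed (use fP in \<open>simp_all add: linear_def\<close>)
    moreover have "\<zero>\<^bsub>P\<^esub> \<in> Q" using Q.zero_closed by simp
    ultimately show ?thesis using c0 c1 by blast
  next
    case False
    then obtain l where l: "n = l + 2" by (metis add.commute le_add_diff_inverse not_less_eq_eq one_add_one plus_1_eq_Suc)
    let ?c = "coeff P f n" and ?m = "monom P (coeff P f n) l \<otimes>\<^bsub>P\<^esub> q"
    have c: "?c \<in> carrier R" using fP by simp
    have m: "?m \<in> Q" using monom_times_q_in_Q[of ?c l] co[of n] l by simp
    then have mA: "?m \<in> carrier A" by simp
    then have mP: "?m \<in> carrier P" using A_carrier_subset by blast
    let ?f = "f \<oplus>\<^bsub>P\<^esub> (\<ominus>\<^bsub>P\<^esub> ?m)"
    have "\<ominus>\<^bsub>P\<^esub> ?m \<in> carrier A" using subringE(5)[OF subring_A mA] .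
    then have fA: "?f \<in> carrier A" using A.a_closed[OF less.prems(1), of "\<ominus>\<^bsub>P\<^esub> ?m"] by simp
    have "coeff P ?f k = \<zero>" if "k > l + 1" for k
    proof -
      have "coeff P ?m k = (if k = n then ?c else \<zero>)"
        unfolding monom_times_q[OF c] using that c a b l by simp
      moreover have "coeff P f k = (if k = n then ?c else \<zero>)" using that l less.prems(2)[of k] by auto
      moreover have "coeff P ?f k = coeff P f k \<ominus> coeff P ?m k"
        using fP mP by (simp add: a_minus_def del: U.coeff_mult)
      ultimately show ?thesis using c by (simp add: a_minus_def r_neg)
    qed
    then obtain g r i where g: "g \<in> Q" "r \<in> carrier R" "i \<in> I" "?f = g \<oplus>\<^bsub>P\<^esub> linear r i"
      using less.IH[of "l + 1" ?f] fA l by auto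
    have lP: "linear r i \<in> carrier P" "g \<in> carrier P"
      using linear_in_A[OF g(2,3)] g(1) A_carrier_subset by auto
    have "f = ?f \<oplus>\<^bsub>P\<^esub> ?m" using fP mP by (simp add: U.P.a_assoc U.P.l_neg)
    also have "\<dots> = (g \<oplus>\<^bsub>P\<^esub> ?m) \<oplus>\<^bsub>P\<^esub> linear r i" unfolding g(4) using lP mP by (simp add: U.P.a_ac)
    finally have "f = (g \<oplus>\<^bsub>P\<^esub> ?m) \<oplus>\<^bsub>P\<^esub> linear r i" .
    moreover have "g \<oplus>\<^bsub>P\<^esub> ?m \<in> Q" using Q.a_closed[OF g(1) m] by simp
    ultimately show ?thesis using g(2,3) by blast
  qed
qed

lemma I_subset: "I \<subseteq> \<mm>"
proof (rule subsetI, rule ccontr)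
  fix x assume x: "x \<in> I" "x \<notin> \<mm>"
  then have "x \<in> Units R" using I.a_Hcarr Units_if_notin_\<mm> by simp
  then have "I = carrier R" by (rule ideal_eq_carrier_if_unit[OF I.is_ideal x(1)])
  then show False using I_proper by simp
qed

abbreviation \<phi> :: "'a \<Rightarrow> 'a \<Rightarrow> (nat \<Rightarrow> 'a) set"
  where "\<phi> r i \<equiv> Q +>\<^bsub>A\<^esub> linear r i"

lemma rees_quot_eq: "rees_quot R I a b = A Quot Q"
  by (simp add: rees_quot_def)

lemma \<phi>_bij: "bij_betw (\<lambda>(r, i). \<phi> r i) (carrier R \<times> I) (carrier (A Quot Q))"
proof (rule bij_betw_imageI)
  show "inj_on (\<lambda>(r, i). \<phi> r i) (carrier R \<times> I)"
  proof (rule inj_onI, clarify)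
    fix r i s j assume c: "r \<in> carrier R" "i \<in> I" "s \<in> carrier R" "j \<in> I" and eq: "\<phi> r i = \<phi> s j"
    obtain g where g: "g \<in> Q" "linear r i = g \<oplus>\<^bsub>A\<^esub> linear s j"
      using eq linear_in_A[OF c(1,2)] by (rule Q.coset_eq_imp_add)
    have gP: "g \<in> carrier P" using g(1) A_carrier_subset by auto
    have co: "coeff P (linear r i) n = coeff P g n \<oplus> coeff P (linear s j) n" for n
      using g(2) gP c by (simp add: linear_def)
    have "coeff P g n = \<zero>" if "n \<ge> 2" for n
      using co[of n] that c gP by (simp add: linear_def)
    then have "g = \<zero>\<^bsub>P\<^esub>" using g(1) by (intro q_multiple_of_degree_le_1) auto
    then have "coeff P (linear r i) n = coeff P (linear s j) n" for n
      using co[of n] c by (simp add: linear_def)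
    from this[of 0] this[of 1] show "r = s \<and> i = j" using c by (simp add: linear_def)
  qed
  show "(\<lambda>(r, i). \<phi> r i) ` (carrier R \<times> I) = carrier (A Quot Q)"
  proof
    show "(\<lambda>(r, i). \<phi> r i) ` (carrier R \<times> I) \<subseteq> carrier (A Quot Q)"
      using linear_in_A by (auto simp: FactRing_def A_RCOSETS_def')
    show "carrier (A Quot Q) \<subseteq> (\<lambda>(r, i). \<phi> r i) ` (carrier R \<times> I)"
    proof
      fix C assume "C \<in> carrier (A Quot Q)"
      then obtain f where f: "f \<in> carrier A" "C = Q +>\<^bsub>A\<^esub> f" by (auto simp: FactRing_def A_RCOSETS_def')
      have "f \<in> carrier P" using f(1) A_carrier_subset by blast
      then obtain g r i where g: "g \<in> Q" "r \<in> carrier R" "i \<in> I" "f = g \<oplus>\<^bsub>P\<^esub> linear r i"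
        using linear_reduction[OF f(1), of "deg R f"] U.deg_aboveD[of f] by blast
      have "C = \<phi> r i"
        using Q.coset_add_absorb[OF g(1) linear_in_A[OF g(2,3)]] unfolding f(2) g(4) by simp
      then show "C \<in> (\<lambda>(r, i). \<phi> r i) ` (carrier R \<times> I)" using g(2,3) by force
    qed
  qed
qed

lemma quadratic_extension_rees_quot:
  "quadratic_extension R \<mm> I (rees_quot R I a b) \<phi> a b"
  unfolding rees_quot_eq
proof (intro quadratic_extension.intro quadratic_extension_axioms.intro)
  show "local_cring R \<mm>" by (rule local_cring_axioms)
  show "ideal I R" by (rule I.is_ideal)
  show "cring (A Quot Q)" by (rule Q.quotient_is_cring[OF A.is_cring])
  have "linear \<one> \<zero> = \<one>\<^bsub>A\<^esub>" by (simp add: linear_def U.monom_one U.monom_zero)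
  then show "\<phi> \<one> \<zero> = \<one>\<^bsub>A Quot Q\<^esub>" by (simp add: FactRing_def)
  fix r s i j assume c: "r \<in> carrier R" "s \<in> carrier R" "i \<in> I" "j \<in> I"
  have lA: "linear r i \<in> carrier A" "linear s j \<in> carrier A" using c linear_in_A by auto
  show "\<phi> r i \<oplus>\<^bsub>A Quot Q\<^esub> \<phi> s j = \<phi> (r \<oplus> s) (i \<oplus> j)"
    using Q.a_rcos_sum[OF lA] linear_add[OF c] by (simp add: FactRing_def)
  have "i \<otimes> j \<in> ideal_power R I (0 + 2)"
  proof -
    have "i \<otimes> j \<in> I \<cdot> I" using c(3,4) by (rule ideal_prod.prod)
    also have "I \<cdot> I = ideal_power R I 1 \<cdot> ideal_power R I 1" by (simp only: ideal_power_1[OF I.is_ideal])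
    also have "\<dots> = ideal_power R I (1 + 1)" by (rule ideal_power_add[OF I.is_ideal, symmetric])
    finally show ?thesis by (simp only: add_0 one_add_one)
  qed
  then have m: "monom P (i \<otimes> j) 0 \<otimes>\<^bsub>P\<^esub> q \<in> Q" by (rule monom_times_q_in_Q)
  have "r \<otimes> s \<ominus> b \<otimes> (i \<otimes> j) \<in> carrier R" using c b by simp
  moreover have "r \<otimes> j \<oplus> s \<otimes> i \<ominus> a \<otimes> (i \<otimes> j) \<in> I"
    using c a by (intro ideal_minus_closed[OF I.is_ideal] I.a_closed I.I_l_closed) auto
  ultimately have "linear (r \<otimes> s \<ominus> b \<otimes> (i \<otimes> j)) (r \<otimes> j \<oplus> s \<otimes> i \<ominus> a \<otimes> (i \<otimes> j)) \<in> carrier A"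
    by (rule linear_in_A)
  from Q.coset_add_absorb[OF m this]
  show "\<phi> r i \<otimes>\<^bsub>A Quot Q\<^esub> \<phi> s j = \<phi> (r \<otimes> s \<ominus> b \<otimes> (i \<otimes> j)) (r \<otimes> j \<oplus> s \<otimes> i \<ominus> a \<otimes> (i \<otimes> j))"
    using Q.rcoset_mult_add[OF lA] linear_mult[OF c] by (simp add: FactRing_def)
qed (use a b I_subset \<phi>_bij in simp_all)

end

theorem proposition2p3:
  fixes R :: "('a, 'm) ring_scheme" and I :: "'a set"
  assumes "noetherian_local_ring R"
    and "ideal I R" and "I \<noteq> carrier R"
  shows "(\<forall>a \<in> carrier R. \<forall>b \<in> carrier R. \<forall>a' \<in> carrier R. \<forall>b' \<in> carrier R.
            hilbert_fun (rees_quot R I a b) = hilbert_fun (rees_quot R I a' b'))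
       \<and> (\<forall>a \<in> carrier R. \<forall>b \<in> carrier R.
            embedding_dim (rees_quot R I a b) = embedding_dim R + min_gens R I)
       \<and> (\<forall>a \<in> carrier R. \<forall>b \<in> carrier R. \<forall>a' \<in> carrier R. \<forall>b' \<in> carrier R.
            multiplicity (rees_quot R I a b) = multiplicity (rees_quot R I a' b'))"
proof -
  interpret R: noetherian_local_ring R by fact
  let ?\<mm> = "max_ideal R"
  have extension: "quadratic_extension R ?\<mm> I (rees_quot R I a b) (\<lambda>r i. a_r_coset (rees_algebra R I)
      (cgenideal (UP R) (quad_poly R a b) \<inter> carrier (rees_algebra R I)) (rees_quotient.linear R r i)) a b"
    if "a \<in> carrier R" "b \<in> carrier R" for a b
    by (rule rees_quotient.quadratic_extension_rees_quot)
      (intro rees_quotient.intro rees_quotient_axioms.intro R.local_cring_max_ideal assms that)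
  define H where "H = (\<lambda>k. chain_sup (quadratic_extension.layer_submodules R ?\<mm> I k))"
  \<comment> \<open>The right-hand side mentions only \<open>R\<close> and \<open>I\<close>.\<close>
  have hilb: "hilbert_fun (rees_quot R I a b) = H" if "a \<in> carrier R" "b \<in> carrier R" for a b
    unfolding H_def by (rule ext, rule quadratic_extension.hilbert_fun_eq[OF extension[OF that]])
  have mult: "multiplicity (rees_quot R I a b) = (let d = the_enat (krull_dim R) in
      lim (\<lambda>k. fact d * real (the_enat (\<Sum>j<k. H j)) / real k ^ d))"
    if ab: "a \<in> carrier R" "b \<in> carrier R" for a b
  proof -
    interpret E: quadratic_extension R ?\<mm> I "rees_quot R I a b" "\<lambda>r i. a_r_coset (rees_algebra R I)
      (cgenideal (UP R) (quad_poly R a b) \<inter> carrier (rees_algebra R I)) (rees_quotient.linear R r i)" a b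
      by (rule extension[OF ab])
    show ?thesis unfolding E.S.multiplicity_eq E.krull_dim_eq hilb[OF ab] ..
  qed
  have emb: "embedding_dim (rees_quot R I a b) = embedding_dim R + min_gens R I"
    if "a \<in> carrier R" "b \<in> carrier R" for a b
    by (rule quadratic_extension.embedding_dim_eq[OF extension[OF that] R.noetherian_ring_axioms])
  show ?thesis using hilb mult emb by simp
qed

end
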